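(* Let $\mathcal I=\Psi+\mathcal F:X\to(-\infty,+\infty]$, where $\mathcal F\in C^1(X,\mathbb R)$ and $\Psi:X\to(-\infty,+\infty]$ is convex, lower semicontinuous with $D(\Psi)=\{q\in X:\Psi(q)<+\infty\}\neq\emptyset$, and $\Psi$, $\mathcal F$ (hence $\mathcal I$) are invariant. Assume that $\mathcal I$ is bounded from below; that there exists $\alpha>0$ such that the function $D(\Psi)\ni q\mapsto\mathcal I(q)+\alpha\|q\|^2$ is convex; that $\mathcal I(0)=0$; that there exists $\omega<0$ such that $\mathcal I$ satisfies the $(wPS)_d$-condition for all $d<\omega$; and that $\operatorname{Fix}(S^1)\cap\Omega\cap K(\mathcal I)=\emptyset$. Let $0<\varepsilon<\alpha^{-1}$. (1) $K_{c_j(\mathcal I_\varepsilon)}(\mathcal I_\varepsilon)=K_{c_j(\mathcal I_\varepsilon)}(\mathcal I)$ is a nonempty set for all positive integers $j$ such that $c_j(\mathcal I_\varepsilon)<\omega$. (2) Moreover, if there exist positive integers $j<k$ with $c_j(\mathcal I_\varepsilon)=c_k(\mathcal I_\varepsilon)<\omega$, then $K_{c_j(\mathcal I_\varepsilon)}(\mathcal I)$ contains infinitely many orbits. (3) In particular, if for some positive integer $k$ one has $c_k(\mathcal I_\varepsilon)<\omega$, then $K(\mathcal I)$ contains at least $k$ orbits at negative levels (i.e. at least $k$ distinct orbits $\mathcal O(q)$ with $\mathcal I(q)<0$).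
   Context: $(X,\langle\cdot,\cdot\rangle)$ is a real Hilbert space and $(Y,\|\cdot\|_Y)$ a real Banach space with $X\subset Y$ such that the canonical injection $X\to Y$ is a compact operator. $S^1$ is identified with $\mathbb R/2\pi\mathbb Z$. An isometric representation of $S^1$ over a Banach space $\mathcal X$ is a map $\theta\mapsto L(\theta)$ into the bounded linear operators on $\mathcal X$ with $L(0)=\mathrm{id}$, $L(\theta_1+\theta_2)=L(\theta_1)L(\theta_2)$, $(\theta,x)\mapsto L(\theta)x$ continuous, and each $L(\theta)$ norm-preserving. Let $L$ be an isometric representation of $S^1$ over $Y$ such that $L(\theta)X=X$ for all $\theta$ and the restrictions $L(\theta)|_X$ form an isometric representation of $S^1$ over $X$. Let $\operatorname{Fix}(S^1)=\{y\in Y: L(\theta)y=y\ \forall\theta\in S^1\}$ and assume $\operatorname{Fix}(S^1)\subset X$. The orbit of $y$ is $\mathcal O(y)=\{L(\theta)y:\theta\in S^1\}$. A set $A$ is invariant if $L(\theta)A=A$ for all $\theta$; a functional on $X$ is invariant if it is unchanged by composition with each $L(\theta)$. $S^1$-index: for a closed invariant $A\subset X$, $\operatorname{ind}(A)$ is the smallest integer $k$ for which there exist an integer $n\geq 1$ and a continuous $\Phi:A\to\mathbb C^k\setminus\{0\}$ with $\Phi(L(\theta)x)=e^{in\theta}\Phi(x)$ for all $\theta\in S^1$, $x\in A$; $\operatorname{ind}(A)=+\infty$ if no such map exists; $\operatorname{ind}(\emptyset)=0$. For a positive integer $j$, $\mathcal G_j=\{A\subset X: A\text{ compact, invariant, }\operatorname{ind}(A)\geq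 j\}$. A critical point of $\mathcal I$ is a $q\in D(\Psi)$ with $\Psi(\varphi)-\Psi(q)+\mathcal F'(q)[\varphi-q]\geq0$ for all $\varphi\in D(\Psi)$. $K(\mathcal I)$ is the set of critical points of $\mathcal I$, $K_c(\mathcal I)=\{q\in K(\mathcal I):\mathcal I(q)=c\}$; these sets are invariant. $\Omega=\{q\in X:\mathcal I(q)<0\}$. A $(PS)$-sequence at the level $c\in\mathbb R$ for $\mathcal I$ is a sequence $(q_n)\subset D(\Psi)$ with $\mathcal I(q_n)\to c$ for which there is $(\varepsilon_n)\subset[0,\infty)$, $\varepsilon_n\to0$, with $\Psi(\varphi)-\Psi(q_n)+\mathcal F'(q_n)[\varphi-q_n]\geq-\varepsilon_n\|\varphi-q_n\|$ for all $\varphi\in D(\Psi)$ and all $n$. $\mathcal I$ satisfies the $(wPS)_c$-condition if every $(PS)$-sequence at the level $c$ has a subsequence converging in $Y$ to a critical point $q^*$ of $\mathcal I$ with $\mathcal I(q^* )=c$. For $0<\varepsilon<\alpha^{-1}$, $\mathcal I_\varepsilon:X\to\mathbb R$ is $\mathcal I_\varepsilon(q)=\inf_{\varphi\in X}(\varepsilon^{-1}\|\varphi-q\|^2+\mathcal I(\varphi))$; when $\mathcal I=\Psi+\mathcal F$ with $\mathcal F\in C^1(X,\mathbb R)$ and $\Psi:X\to(-\infty,+\infty]$ convex, lower semicontinuous with $D(\Psi)\neq\emptyset$, $\Psi$ and $\mathcal F$ are invariant, $\mathcal I$ is bounded from below, and $\alpha>0$ is such that $D(\Psi)\ni q\mapsto\mathcal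 I(q)+\alpha\|q\|^2$ is convex, one has that $\mathcal I_\varepsilon\in C^1(X,\mathbb R)$ and it is invariant (Ekeland–Lasry). Put $c_j(\mathcal I_\varepsilon)=\inf_{A\in\mathcal G_j}\max_A\mathcal I_\varepsilon$ and $K_c(\mathcal I_\varepsilon)=\{q\in X:\mathcal I_\varepsilon(q)=c,\ \mathcal I_\varepsilon'(q)=0\}$. *)

theory Defs
  imports "HOL-Analysis.Analysis"
begin

section \<open>Isometric representations of the circle\<close>

text \<open>
  A map on \<open>S\<^sup>1 = \<real>/2\<pi>\<int>\<close> is given as a \<open>2\<pi>\<close>-periodic map on the reals; joint continuity over
  \<open>S\<^sup>1\<close> is then the same as joint continuity over the reals.
\<close>

definition isometric_rep :: "(real \<Rightarrow> 'a::real_normed_vector \<Rightarrow> 'a) \<Rightarrow> bool" where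
  "isometric_rep L \<longleftrightarrow>
     (\<forall>\<theta>. L (\<theta> + 2 * pi) = L \<theta>) \<and>
     (\<forall>\<theta>. bounded_linear (L \<theta>)) \<and>
     L 0 = id \<and>
     (\<forall>\<theta>1 \<theta>2. L (\<theta>1 + \<theta>2) = L \<theta>1 \<circ> L \<theta>2) \<and>
     continuous_on UNIV (\<lambda>(\<theta>, x). L \<theta> x) \<and>
     (\<forall>\<theta> x. norm (L \<theta> x) = norm x)"

definition fixed_points :: "(real \<Rightarrow> 'a \<Rightarrow> 'a) \<Rightarrow> 'a set" where
  "fixed_points L = {y. \<forall>\<theta>. L \<theta> y = y}"

definition orbit :: "(real \<Rightarrow> 'a \<Rightarrow> 'a) \<Rightarrow> 'a \<Rightarrow> 'a set" where
  "orbit L y = range (\<lambda>\<theta>. L \<theta> y)"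

definition orbits_in :: "(real \<Rightarrow> 'a \<Rightarrow> 'a) \<Rightarrow> 'a set \<Rightarrow> 'a set set" where
  "orbits_in L S = {orbit L q | q. orbit L q \<subseteq> S}"

definition invariant_set :: "(real \<Rightarrow> 'a \<Rightarrow> 'a) \<Rightarrow> 'a set \<Rightarrow> bool" where
  "invariant_set L A \<longleftrightarrow> (\<forall>\<theta>. L \<theta> ` A = A)"

definition invariant_functional :: "(real \<Rightarrow> 'a \<Rightarrow> 'a) \<Rightarrow> ('a \<Rightarrow> 'b) \<Rightarrow> bool" where
  "invariant_functional L f \<longleftrightarrow> (\<forall>\<theta>. f \<circ> L \<theta> = f)"

text \<open>
  The inclusion \<open>X \<subset> Y\<close> of spaces with different norms is an injective linear map \<open>\<iota>\<close> between
  two types. The restriction to \<open>X\<close> of a representation \<open>L\<close> over \<open>Y\<close> is meaningful when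
  \<open>L \<theta>\<close> maps \<open>range \<iota>\<close> into itself.
\<close>

definition compact_operator :: "('a::real_normed_vector \<Rightarrow> 'b::real_normed_vector) \<Rightarrow> bool" where
  "compact_operator T \<longleftrightarrow> bounded_linear T \<and> (\<forall>B. bounded B \<longrightarrow> compact (closure (T ` B)))"

definition restrict_rep :: "('x \<Rightarrow> 'y) \<Rightarrow> (real \<Rightarrow> 'y \<Rightarrow> 'y) \<Rightarrow> real \<Rightarrow> 'x \<Rightarrow> 'x" where
  "restrict_rep \<iota> L \<theta> x = inv \<iota> (L \<theta> (\<iota> x))"


section \<open>The index\<close>

text \<open>
  A map into \<open>\<complex>\<^sup>k - {0}\<close> is given by its components \<open>\<Phi> 0, \<dots>, \<Phi> (k - 1)\<close>. For \<open>k = 0\<close> the target is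
  empty, so the index is 0 exactly for the empty set; when there is no admissible \<open>k\<close>, the
  infimum in \<open>enat\<close> is \<open>\<infinity>\<close>.
\<close>

definition ind :: "(real \<Rightarrow> 'a::topological_space \<Rightarrow> 'a) \<Rightarrow> 'a set \<Rightarrow> enat" where
  "ind L A = Inf {enat k | k. \<exists>n::nat. \<exists>\<Phi> :: nat \<Rightarrow> 'a \<Rightarrow> complex.
     n \<ge> 1 \<and>
     (\<forall>i<k. continuous_on A (\<Phi> i)) \<and>
     (\<forall>x\<in>A. \<exists>i<k. \<Phi> i x \<noteq> 0) \<and>
     (\<forall>\<theta>. \<forall>x\<in>A. \<forall>i<k. \<Phi> i (L \<theta> x) = exp (\<i> * of_nat n * complex_of_real \<theta>) * \<Phi> i x)}"

definition index_class :: "(real \<Rightarrow> 'a::topological_space \<Rightarrow> 'a) \<Rightarrow> nat \<Rightarrow> 'a set set" where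
  "index_class L j = {A. compact A \<and> invariant_set L A \<and> ind L A \<ge> enat j}"

text \<open>
  For \<open>j \<ge> 1\<close> the members of \<open>index_class L j\<close> are compact and nonempty, so for continuous \<open>G\<close>
  the inner supremum is a maximum. The infimum over an empty class is \<open>\<infinity>\<close>.
\<close>

definition minimax_level :: "(real \<Rightarrow> 'a::topological_space \<Rightarrow> 'a) \<Rightarrow> ('a \<Rightarrow> real) \<Rightarrow> nat \<Rightarrow> ereal" where
  "minimax_level L G j = (INF A\<in>index_class L j. SUP x\<in>A. ereal (G x))"


section \<open>Functionals of the form convex plus smooth\<close>

definition edom :: "('x \<Rightarrow> ereal) \<Rightarrow> 'x set" where
  "edom \<Psi> = {q. \<Psi> q < \<infinity>}"

text \<open>Note that \<open>0 * \<infinity> = 0\<close> in \<open>ereal\<close>, so the endpoints of the segment impose no condition.\<close>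

definition econvex :: "('x::real_vector \<Rightarrow> ereal) \<Rightarrow> bool" where
  "econvex \<Psi> \<longleftrightarrow> (\<forall>x y. \<forall>u\<ge>0. \<forall>v\<ge>0. u + v = 1 \<longrightarrow>
     \<Psi> (u *\<^sub>R x + v *\<^sub>R y) \<le> ereal u * \<Psi> x + ereal v * \<Psi> y)"

definition lower_semicontinuous :: "('x::topological_space \<Rightarrow> ereal) \<Rightarrow> bool" where
  "lower_semicontinuous \<Psi> \<longleftrightarrow> (\<forall>x. \<Psi> x \<le> Liminf (at x) \<Psi>)"

definition C1_functional :: "('x::real_normed_vector \<Rightarrow> real) \<Rightarrow> bool" where
  "C1_functional F \<longleftrightarrow> (\<exists>F' :: 'x \<Rightarrow> 'x \<Rightarrow>\<^sub>L real.
     (\<forall>x. (F has_derivative blinfun_apply (F' x)) (at x)) \<and> continuous_on UNIV F')"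

definition total_functional :: "('x \<Rightarrow> ereal) \<Rightarrow> ('x \<Rightarrow> real) \<Rightarrow> 'x \<Rightarrow> ereal" where
  "total_functional \<Psi> F q = \<Psi> q + ereal (F q)"

definition sublevel_neg :: "('x \<Rightarrow> ereal) \<Rightarrow> ('x \<Rightarrow> real) \<Rightarrow> 'x set" where
  "sublevel_neg \<Psi> F = {q. total_functional \<Psi> F q < 0}"

text \<open>
  The derivative \<open>F'(q)\<close> is \<open>frechet_derivative F (at q)\<close>. Since \<open>\<Psi>\<close> never takes the value
  \<open>-\<infinity>\<close>, all differences of values of \<open>\<Psi>\<close> below are differences of finite numbers.
\<close>

definition critical_points :: "('x::real_normed_vector \<Rightarrow> ereal) \<Rightarrow> ('x \<Rightarrow> real) \<Rightarrow> 'x set" where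
  "critical_points \<Psi> F = {q \<in> edom \<Psi>. \<forall>\<phi>\<in>edom \<Psi>.
     \<Psi> \<phi> - \<Psi> q + ereal (frechet_derivative F (at q) (\<phi> - q)) \<ge> 0}"

definition critical_points_at ::
    "('x::real_normed_vector \<Rightarrow> ereal) \<Rightarrow> ('x \<Rightarrow> real) \<Rightarrow> ereal \<Rightarrow> 'x set" where
  "critical_points_at \<Psi> F c = {q \<in> critical_points \<Psi> F. total_functional \<Psi> F q = c}"

definition PS_sequence ::
    "('x::real_normed_vector \<Rightarrow> ereal) \<Rightarrow> ('x \<Rightarrow> real) \<Rightarrow> real \<Rightarrow> (nat \<Rightarrow> 'x) \<Rightarrow> bool" where
  "PS_sequence \<Psi> F c q \<longleftrightarrow>
     (\<forall>n. q n \<in> edom \<Psi>) \<and>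
     (\<lambda>n. total_functional \<Psi> F (q n)) \<longlonglongrightarrow> ereal c \<and>
     (\<exists>e :: nat \<Rightarrow> real. (\<forall>n. e n \<ge> 0) \<and> e \<longlonglongrightarrow> 0 \<and>
        (\<forall>n. \<forall>\<phi>\<in>edom \<Psi>.
           \<Psi> \<phi> - \<Psi> (q n) + ereal (frechet_derivative F (at (q n)) (\<phi> - q n))
             \<ge> ereal (- e n * norm (\<phi> - q n))))"

definition wPS ::
    "('x::real_normed_vector \<Rightarrow> 'y::real_normed_vector) \<Rightarrow> ('x \<Rightarrow> ereal) \<Rightarrow> ('x \<Rightarrow> real) \<Rightarrow> real \<Rightarrow> bool"
  where
  "wPS \<iota> \<Psi> F c \<longleftrightarrow> (\<forall>q. PS_sequence \<Psi> F c q \<longrightarrow>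
     (\<exists>r qs. strict_mono (r :: nat \<Rightarrow> nat) \<and> (\<lambda>n. \<iota> (q (r n))) \<longlonglongrightarrow> \<iota> qs \<and>
        qs \<in> critical_points_at \<Psi> F (ereal c)))"

text \<open>
  The infimum is finite when the functional is bounded from below and not identically \<open>\<infinity>\<close>.
\<close>

definition regularization ::
    "('x::real_normed_vector \<Rightarrow> ereal) \<Rightarrow> ('x \<Rightarrow> real) \<Rightarrow> real \<Rightarrow> 'x \<Rightarrow> real" where
  "regularization \<Psi> F \<epsilon> q =
     real_of_ereal (INF \<phi>. ereal (inverse \<epsilon> * (norm (\<phi> - q))\<^sup>2) + total_functional \<Psi> F \<phi>)"

definition smooth_critical_points_at :: "('x::real_normed_vector \<Rightarrow> real) \<Rightarrow> ereal \<Rightarrow> 'x set" where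
  "smooth_critical_points_at G c = {q. ereal (G q) = c \<and> (G has_derivative (\<lambda>_. 0)) (at q)}"

end

theory Submission
  imports Defs
begin

text \<open>
  The idea is to replace the gradient flow of the regularization \<open>I\<^sub>\<epsilon>\<close> by its proximal map. Since
  \<open>1/\<epsilon> > \<alpha>\<close>, the function \<open>x \<mapsto> \<parallel>x - q\<parallel>\<^sup>2/\<epsilon> + I x\<close> is strongly convex, so it has exactly one
  minimizer \<open>prox q\<close>. Strong convexity makes \<open>prox\<close> Lipschitz, uniqueness makes it equivariant, and
  \<open>I\<^sub>\<epsilon> (prox q) \<le> I (prox q) = I\<^sub>\<epsilon> q - \<parallel>prox q - q\<parallel>\<^sup>2/\<epsilon>\<close>. Thus \<open>prox\<close> is an equivariant deformation
  that lowers \<open>I\<^sub>\<epsilon>\<close> in a single step, by an amount that controls how far it moves. Its fixed points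
  are at the same time the zeros of the derivative of \<open>I\<^sub>\<epsilon>\<close> (\<open>envelope_stationary_iff\<close>) and the
  critical points of \<open>I\<close> (\<open>critical_iff_prox\<close>), which gives the equality of the two critical sets.

  Let \<open>c\<close> be the \<open>j\<close>-th level and let \<open>A\<^sub>n\<close> be sets of index at least \<open>j\<close> on which
  \<open>I\<^sub>\<epsilon> < c + 1/n\<close>. The image \<open>prox A\<^sub>n\<close> also has index at least \<open>j\<close>, so \<open>A\<^sub>n\<close> contains some
  \<open>x\<^sub>n\<close> with \<open>I\<^sub>\<epsilon> (prox x\<^sub>n) > c - 1/n\<close>. Then \<open>\<parallel>prox x\<^sub>n - x\<^sub>n\<parallel>\<close> tends to 0, the points \<open>prox x\<^sub>n\<close> form a
  Palais--Smale sequence of \<open>I\<close> at the level \<open>c\<close> (\<open>prox_PS_sequence\<close>), and a subsequence of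
  \<open>x\<^sub>n\<close> converges in \<open>Y\<close> to a critical point at the level \<open>c\<close>. This is
  \<open>almost_optimal_sets_accumulate\<close>; it shows that every level below \<open>\<omega>\<close> is critical.

  Suppose that two levels \<open>j < k\<close> coincide and that only finitely many critical orbits lie on the
  common level \<open>c < 0\<close>. None of these orbits is a fixed point, so averaging a bump function over the
  circle produces a continuous equivariant \<open>\<psi> : Y \<rightarrow> \<complex>\<close> without zeros on them
  (\<open>equivariant_map_nonzero_on_orbits\<close>). Removing \<open>{\<psi> \<noteq> 0}\<close> from a set lowers the index by at most
  one (\<open>index_class_remove\<close>). Hence the sets \<open>A\<^sub>n \<inter> {\<psi> = 0}\<close>, with \<open>A\<^sub>n\<close> almost optimal for the
  \<open>k\<close>-th level, still have index at least \<open>j\<close>, and the accumulation argument finds a critical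
  point at the level \<open>c\<close> in the closed set \<open>{\<psi> = 0}\<close>, a contradiction. As \<open>\<psi>\<close> is continuous for
  the norm of \<open>Y\<close>, convergence in \<open>Y\<close> is enough here.

  The levels are nondecreasing in \<open>j\<close>, so if the \<open>k\<close>-th one is below \<open>\<omega>\<close>, then so are those
  before it. Either the first \<open>k\<close> levels are distinct, and critical points on different levels lie
  on different orbits, or two of them coincide and one level already carries infinitely many orbits.
\<close>

section \<open>Orbits and stabilizers\<close>

lemma isometric_rep_add: "isometric_rep L \<Longrightarrow> L (s + t) x = L s (L t x)"
  by (simp add: isometric_rep_def)

lemma isometric_rep_zero: "isometric_rep L \<Longrightarrow> L 0 x = x"
  by (simp add: isometric_rep_def)

lemma isometric_rep_periodic: "isometric_rep L \<Longrightarrow> L (t + 2 * pi) x = L t x"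
  unfolding isometric_rep_def by metis

lemma isometric_rep_inverse: "isometric_rep L \<Longrightarrow> L (- t) (L t x) = x"
  by (metis add.left_inverse isometric_rep_add isometric_rep_zero)

lemma isometric_rep_continuous:
  assumes "isometric_rep L" "continuous_on S f" "continuous_on S g"
  shows "continuous_on S (\<lambda>x. L (f x) (g x))"
proof -
  have "continuous_on UNIV (\<lambda>(t, x). L t x)"
    using assms(1) by (simp add: isometric_rep_def)
  from continuous_on_compose2[OF this, of S "\<lambda>x. (f x, g x)"] show ?thesis
    using assms(2,3) by (auto intro: continuous_on_Pair)
qed

lemma orbit_eq_if_mem:
  assumes "isometric_rep L" "y \<in> orbit L x"
  shows "orbit L y = orbit L x"
proof -
  obtain s where s: "y = L s x" using assms(2) by (auto simp: orbit_def)
  then have x: "x = L (- s) y" using isometric_rep_inverse[OF assms(1)] by simp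
  have "L t y \<in> orbit L x" for t
    by (auto simp: orbit_def s simp flip: isometric_rep_add[OF assms(1)])
  moreover have "L t x \<in> orbit L y" for t
    by (subst x) (auto simp: orbit_def simp flip: isometric_rep_add[OF assms(1)])
  ultimately show ?thesis by (auto simp: orbit_def)
qed

lemma mem_orbit: "isometric_rep L \<Longrightarrow> x \<in> orbit L x"
  by (metis isometric_rep_zero orbit_def rangeI)

lemma isometric_rep_stabilizer:
  assumes L: "isometric_rep L" and stab: "L t x = x"
  shows "L (of_int m * t) x = x"
proof -
  have nat: "L (of_nat n * t) x = x" for n
  proof (induction n)
    case (Suc n)
    have "of_nat (Suc n) * t = t + of_nat n * t"
      by (simp add: distrib_right)
    then have "L (of_nat (Suc n) * t) x = L t (L (of_nat n * t) x)"
      by (simp only: isometric_rep_add[OF L])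
    then show ?case
      using Suc stab by simp
  qed (simp add: isometric_rep_zero[OF L])
  show ?thesis
  proof (cases "m \<ge> 0")
    case True
    then show ?thesis
      using nat[of "nat m"] by simp
  next
    case False
    define n where "n = nat (- m)"
    have m: "of_int m * t = - (of_nat n * t)"
      using False by (simp add: n_def)
    show ?thesis
      using isometric_rep_inverse[OF L, of "of_nat n * t" x] unfolding m nat .
  qed
qed

text \<open>
  The stabilizer of \<open>y\<close> is a closed subgroup of the reals that avoids an interval around \<open>\<theta>\<close>. Its
  positive elements are bounded away from 0, as otherwise their multiples would enter that interval,
  so it is generated by its least positive element. Since \<open>2\<pi>\<close> belongs to it, the generator is
  \<open>2\<pi>/p\<close> for some integer \<open>p\<close>.
\<close>
lemma stabilizer_of_nonfixed_point:
  assumes L: "isometric_rep L" and moved: "L \<theta> y \<noteq> y"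
  obtains p :: nat where "p \<ge> 1" "\<And>t. L t y = y \<Longrightarrow> \<exists>m::int. of_nat p * t = 2 * pi * of_int m"
proof -
  define H where "H = {t. L t y = y}"
  have clH: "closed H"
  proof -
    have "continuous_on UNIV (\<lambda>t. L t y)"
      by (intro isometric_rep_continuous[OF L] continuous_intros)
    from continuous_closed_vimage[of "{y}" "\<lambda>t. L t y"] this show ?thesis
      by (simp add: H_def vimage_def continuous_on_eq_continuous_at)
  qed
  then have "open (- H)" by (rule open_Compl)
  moreover have "\<theta> \<in> - H" using moved by (simp add: H_def)
  ultimately obtain d where d: "d > 0" "\<And>t. dist t \<theta> < d \<Longrightarrow> t \<notin> H"
    unfolding open_dist by auto
  have mult: "of_int m * t \<in> H" if "t \<in> H" for t m
    using that isometric_rep_stabilizer[OF L] by (simp add: H_def)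
  have diff: "s - t \<in> H" if "s \<in> H" "t \<in> H" for s t
    using that isometric_rep_add[OF L, of "s" "-t" y] isometric_rep_inverse[OF L, of t y]
    by (simp add: H_def)
  have ge: "t \<ge> d" if t: "t \<in> H" "t > 0" for t
  proof (rule ccontr)
    assume "\<not> t \<ge> d"
    then have "t < d" by simp
    \<comment> \<open>the largest multiple of \<open>t\<close> up to \<open>\<theta>\<close> would be too close to \<open>\<theta>\<close>\<close>
    have "0 \<le> \<theta> - of_int \<lfloor>\<theta> / t\<rfloor> * t" "\<theta> - of_int \<lfloor>\<theta> / t\<rfloor> * t < t"
      using t(2) floor_divide_lower[of t \<theta>] floor_divide_upper[of t \<theta>]
      by (auto simp: algebra_simps)
    then have "dist (of_int \<lfloor>\<theta> / t\<rfloor> * t) \<theta> < d"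
      using \<open>t < d\<close> by (simp add: dist_real_def)
    with d(2) mult[OF t(1)] show False by blast
  qed
  \<comment> \<open>the positive elements of \<open>H\<close>, as a closed set, so that the least one exists\<close>
  define P where "P = H \<inter> {d..}"
  have twopi: "2 * pi \<in> H"
    using isometric_rep_periodic[OF L, of 0 y] isometric_rep_zero[OF L] by (simp add: H_def)
  have "2 * pi \<in> P"
    using twopi ge[of "2 * pi"] by (simp add: P_def)
  moreover have "bdd_below P" by (auto simp: P_def intro: bdd_belowI[of _ d])
  moreover have "closed P" using clH by (simp add: P_def closed_Int)
  ultimately have t0: "Inf P \<in> P"
    using closed_contains_Inf[of P] by blast
  define t0 where "t0 = Inf P"
  have t0H: "t0 \<in> H" "t0 > 0" using t0 d(1) by (auto simp: P_def t0_def)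
  have gen: "\<exists>m::int. t = of_int m * t0" if t: "t \<in> H" for t
  proof -
    define r where "r = t - of_int \<lfloor>t / t0\<rfloor> * t0"
    have r: "0 \<le> r" "r < t0"
      using t0H(2) floor_divide_lower[of t0 t] floor_divide_upper[of t0 t]
      by (auto simp: algebra_simps r_def)
    have rH: "r \<in> H" unfolding r_def by (intro diff mult t t0H)
    have "r = 0"
    proof (rule ccontr)
      assume "r \<noteq> 0"
      then have "r \<in> P" using r rH ge[of r] by (simp add: P_def)
      then have "t0 \<le> r" unfolding t0_def by (intro cInf_lower \<open>bdd_below P\<close>)
      with r show False by simp
    qed
    then show ?thesis by (auto simp: r_def)
  qed
  obtain n :: int where n: "2 * pi = of_int n * t0" using gen[OF twopi] by auto
  have "n > 0"
  proof (rule ccontr)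
    assume "\<not> n > 0"
    then have "of_int n * t0 \<le> 0" using t0H(2) by (simp add: mult_nonpos_nonneg)
    then show False using n pi_gt_zero by linarith
  qed
  show ?thesis
  proof (rule that[of "nat n"])
    show "1 \<le> nat n" using \<open>n > 0\<close> by simp
    fix t assume "L t y = y"
    then obtain m where m: "t = of_int m * t0" using gen by (auto simp: H_def)
    have "of_nat (nat n) * t = 2 * pi * of_int m"
      using \<open>n > 0\<close> n m by simp
    then show "\<exists>m::int. of_nat (nat n) * t = 2 * pi * of_int m" by blast
  qed
qed

text \<open>
  One exponent has to serve all points at once, because later a single equivariant function must be
  nonzero on several orbits; the product of the orders of the stabilizers is such an exponent.
\<close>
lemma common_period_of_nonfixed_points:
  assumes L: "isometric_rep L" and "finite S" "S \<inter> fixed_points L = {}"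
  obtains p :: nat where "p \<ge> 1"
    "\<And>y t. y \<in> S \<Longrightarrow> L t y = y \<Longrightarrow> \<exists>m::int. of_nat p * t = 2 * pi * of_int m"
proof -
  have "\<forall>y\<in>S. \<exists>p::nat. p \<ge> 1 \<and> (\<forall>t. L t y = y \<longrightarrow> (\<exists>m::int. of_nat p * t = 2 * pi * of_int m))"
  proof
    fix y assume "y \<in> S"
    then obtain \<theta> where "L \<theta> y \<noteq> y" using assms(3) by (auto simp: fixed_points_def)
    from stabilizer_of_nonfixed_point[OF L this]
    show "\<exists>p::nat. p \<ge> 1 \<and> (\<forall>t. L t y = y \<longrightarrow> (\<exists>m::int. of_nat p * t = 2 * pi * of_int m))"
      by metis
  qed
  then obtain p :: "_ \<Rightarrow> nat" where p: "\<And>y. y \<in> S \<Longrightarrow> p y \<ge> 1"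
    "\<And>y t. y \<in> S \<Longrightarrow> L t y = y \<Longrightarrow> \<exists>m::int. of_nat (p y) * t = 2 * pi * of_int m"
    by metis
  show ?thesis
  proof (rule that[of "prod p S"])
    show "1 \<le> prod p S" using p(1) by (intro prod_ge_1) auto
    fix y t assume y: "y \<in> S" "L t y = y"
    obtain m :: int where m: "of_nat (p y) * t = 2 * pi * of_int m" using p(2)[OF y] by blast
    have "prod p S = p y * prod p (S - {y})" using \<open>finite S\<close> y(1) by (simp add: prod.remove)
    then have "of_nat (prod p S) * t = of_nat (prod p (S - {y})) * (of_nat (p y) * t)" by simp
    also have "\<dots> = 2 * pi * of_int (int (prod p (S - {y})) * m)" unfolding m by simp
    finally show "\<exists>m::int. of_nat (prod p S) * t = 2 * pi * of_int m" by blast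
  qed
qed

section \<open>Averaging over the circle\<close>

text \<open>
  For \<open>s \<ge> 0\<close> the integral over \<open>[0, s + T]\<close> can be split at \<open>s\<close> or at \<open>T\<close>, and the pieces over
  \<open>[0, s]\<close> and \<open>[T, s + T]\<close> agree. A negative shift is undone by a positive one.
\<close>
lemma integral_periodic_shift:
  fixes h :: "real \<Rightarrow> 'a::banach"
  assumes cont: "continuous_on UNIV h" and "T > 0" and per: "\<And>x. h (x + T) = h x"
  shows "integral {0..T} (\<lambda>x. h (x + s)) = integral {0..T} h"
proof -
  have pos: "integral {0..T} (\<lambda>x. g (x + s)) = integral {0..T} g"
    if g: "continuous_on UNIV g" "\<And>x. g (x + T) = g x" and "s \<ge> 0" for g :: "real \<Rightarrow> 'a" and s
  proof -
    have int: "g integrable_on {0..s + T}"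
      using g(1) by (intro integrable_continuous_real) (auto intro: continuous_on_subset)
    have shift: "integral {0..b} (\<lambda>x. g (x + c)) = integral {c..b + c} g" for b c
      using integral_shift_Icc_real[of 0 b g c] by (simp add: o_def add.commute)
    have "integral {0..s} g + integral {s..s + T} g = integral {0..s + T} g"
      using \<open>s \<ge> 0\<close> \<open>T > 0\<close> by (intro Henstock_Kurzweil_Integration.integral_combine int) auto
    also have "\<dots> = integral {0..T} g + integral {T..s + T} g"
      using \<open>s \<ge> 0\<close> \<open>T > 0\<close>
      by (intro Henstock_Kurzweil_Integration.integral_combine[symmetric] int) auto
    also have "integral {T..s + T} g = integral {0..s} g"
      using shift[of s T] g(2) by simp
    finally show ?thesis
      using shift[of T s] by (simp add: add.commute)
  qed
  show ?thesis
  proof (cases "s \<ge> 0")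
    case True
    then show ?thesis using pos[of h s] cont per by simp
  next
    case False
    have "integral {0..T} (\<lambda>x. h ((x + - s) + s)) = integral {0..T} (\<lambda>x. h (x + s))"
    proof (rule pos[of "\<lambda>x. h (x + s)" "- s"])
      show "continuous_on UNIV (\<lambda>x. h (x + s))"
        by (intro continuous_on_compose2[OF cont] continuous_intros) auto
      show "h (x + T + s) = h (x + s)" for x
        using per[of "x + s"] by (simp add: ac_simps)
    qed (use False in auto)
    then show ?thesis by simp
  qed
qed

definition weight :: "nat \<Rightarrow> real \<Rightarrow> complex" where
  "weight n \<theta> = exp (\<i> * of_nat n * complex_of_real \<theta>)"

lemma weight_zero: "weight n 0 = 1"
  by (simp add: weight_def)

lemma weight_add: "weight n (s + t) = weight n s * weight n t"
  by (simp add: weight_def exp_add distrib_left)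

lemma continuous_on_weight [continuous_intros]:
  "continuous_on S f \<Longrightarrow> continuous_on S (\<lambda>x. weight n (f x))"
  unfolding weight_def by (intro continuous_intros)

lemma weight_power: "weight n t ^ p = weight (n * p) t"
  by (simp add: weight_def exp_of_nat_mult[symmetric] algebra_simps)

lemma weight_periodic: "weight n (t + 2 * pi) = weight n t"
proof -
  have "weight n (2 * pi) = exp (2 * of_int (int n) * pi * \<i>)"
    by (simp add: weight_def algebra_simps)
  also have "\<dots> = 1"
    by (simp only: exp_integer_2pi Ints_of_int)
  finally show ?thesis
    by (simp only: weight_add mult_1_right)
qed

text \<open>
  The projection of \<open>g\<close>, up to the factor \<open>2\<pi>\<close>, onto the functions of weight \<open>n\<close>: the \<open>n\<close>-th
  Fourier coefficient of \<open>g\<close> along the orbit of \<open>x\<close>.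
\<close>
definition isotypic_average ::
    "(real \<Rightarrow> 'a \<Rightarrow> 'a) \<Rightarrow> nat \<Rightarrow> ('a \<Rightarrow> complex) \<Rightarrow> 'a \<Rightarrow> complex" where
  "isotypic_average L n g x = integral {0..2 * pi} (\<lambda>\<theta>. weight n (- \<theta>) * g (L \<theta> x))"

lemma isotypic_average_continuous:
  assumes L: "isometric_rep L" and g: "continuous_on UNIV g"
  shows "continuous_on UNIV (isotypic_average L n g)"
proof -
  have "continuous_on (UNIV \<times> cbox 0 (2 * pi)) (\<lambda>(x, \<theta>). weight n (- \<theta>) * g (L \<theta> x))"
    unfolding case_prod_beta
    by (intro continuous_intros continuous_on_compose2[OF g] isometric_rep_continuous[OF L]) auto
  from integral_continuous_on_param[OF this] show ?thesis
    unfolding isotypic_average_def by simp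
qed

lemma isotypic_average_equivariant:
  assumes L: "isometric_rep L" and g: "continuous_on UNIV g"
  shows "isotypic_average L n g (L s x) = weight n s * isotypic_average L n g x"
proof -
  define h where "h = (\<lambda>\<theta>. weight n (- \<theta>) * g (L \<theta> x))"
  have "continuous_on UNIV h" unfolding h_def
    by (intro continuous_intros continuous_on_compose2[OF g] isometric_rep_continuous[OF L]) auto
  moreover have "h (t + 2 * pi) = h t" for t
    using weight_periodic[of n "- (t + 2 * pi)"] isometric_rep_periodic[OF L, of t x]
    by (simp add: h_def)
  ultimately have per: "integral {0..2 * pi} (\<lambda>t. h (t + s)) = integral {0..2 * pi} h"
    by (intro integral_periodic_shift) auto
  have w: "weight n (- t) = weight n s * weight n (- (t + s))" for t
    by (simp flip: weight_add)
  have "isotypic_average L n g (L s x) = integral {0..2 * pi} (\<lambda>t. weight n s * h (t + s))"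
    unfolding isotypic_average_def h_def isometric_rep_add[OF L, symmetric]
    by (subst w) (simp add: mult.assoc)
  also have "\<dots> = weight n s * integral {0..2 * pi} h"
    by (simp only: integral_mult_right per)
  finally show ?thesis by (simp add: isotypic_average_def h_def)
qed

text \<open>
  Average a bump function concentrated near \<open>S\<close> against the character of weight \<open>p\<close>, where \<open>p\<close> is a
  common period of the stabilizers. A point of the orbit of \<open>y \<in> S\<close> that lies in \<open>S\<close> is \<open>y\<close> itself, so
  the corresponding angle \<open>t\<close> satisfies \<open>cos (p t) = 1\<close>. By compactness, if the bump is narrow enough then
  \<open>cos (p t) > 0\<close> whenever it does not vanish at \<open>L t y\<close>. Hence the real part of the average at
  \<open>y\<close> is the integral of a nonnegative function that is positive at \<open>t = 0\<close>.
\<close>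
lemma equivariant_map_nonzero_on_orbits:
  fixes L :: "real \<Rightarrow> 'a::real_normed_vector \<Rightarrow> 'a"
  assumes L: "isometric_rep L" and "finite S" and "S \<inter> fixed_points L = {}"
    and reps: "inj_on (orbit L) S"
  obtains \<psi> p where "p \<ge> 1" "continuous_on UNIV \<psi>"
    "\<And>t y. \<psi> (L t y) = weight p t * \<psi> y" "\<And>y. y \<in> S \<Longrightarrow> \<psi> y \<noteq> 0"
proof (cases "S = {}")
  case True
  show ?thesis
    by (rule that[of 1 "\<lambda>_. 0"]) (use True in auto)
next
  case False
  obtain p :: nat where p: "p \<ge> 1"
    "\<And>y t. y \<in> S \<Longrightarrow> L t y = y \<Longrightarrow> \<exists>m::int. of_nat p * t = 2 * pi * of_int m"
    using common_period_of_nonfixed_points[OF L assms(2,3)] by blast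
  have S: "compact S" "closed S" using \<open>finite S\<close> by (auto simp: finite_imp_compact finite_imp_closed)
  have cos1: "cos (of_nat p * t) = 1" if yS: "y \<in> S" and LS: "L t y \<in> S" for y t
  proof -
    have "L t y \<in> orbit L y" by (auto simp: orbit_def)
    then have "orbit L (L t y) = orbit L y" by (rule orbit_eq_if_mem[OF L])
    then have "L t y = y" using reps yS LS by (simp add: inj_on_eq_iff)
    then obtain m :: int where "of_nat p * t = 2 * pi * of_int m" using p(2) yS by blast
    then show ?thesis using cos_int_2pin[of m] by (simp add: ac_simps)
  qed
  \<comment> \<open>the angles that the bump has to avoid, as a compact set\<close>
  define B where "B = {0..2 * pi} \<inter> {t. cos (of_nat p * t) \<le> 0}"
  have "compact B" unfolding B_def
    by (intro compact_Int_closed compact_Icc closed_Collect_le continuous_intros)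
  then have cB: "compact (B \<times> S)" using S(1) by (rule compact_Times)
  have contD: "continuous_on A (\<lambda>z. infdist (L (fst z) (snd z)) S)" for A
    by (intro continuous_on_infdist isometric_rep_continuous[OF L] continuous_intros)
  obtain \<delta> where \<delta>: "\<delta> > 0" "\<And>t y. t \<in> B \<Longrightarrow> y \<in> S \<Longrightarrow> infdist (L t y) S \<ge> \<delta>"
  proof (cases "B \<times> S = {}")
    case True
    show ?thesis by (rule that[of 1]) (use True in auto)
  next
    case ne: False
    obtain z where z: "z \<in> B \<times> S"
      "\<And>w. w \<in> B \<times> S \<Longrightarrow> infdist (L (fst z) (snd z)) S \<le> infdist (L (fst w) (snd w)) S"
      using continuous_attains_inf[OF cB ne contD] by blast
    have "L (fst z) (snd z) \<notin> S"
      using z(1) cos1[of "snd z" "fst z"] by (auto simp: B_def)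
    then have "infdist (L (fst z) (snd z)) S > 0"
      using infdist_pos_not_in_closed[OF S(2) False] by blast
    then show ?thesis using z(2) by (intro that[of "infdist (L (fst z) (snd z)) S"]) force+
  qed
  define g :: "'a \<Rightarrow> real" where "g = (\<lambda>x. max 0 (\<delta> - infdist x S))"
  have gc: "continuous_on UNIV g" unfolding g_def by (intro continuous_intros)
  then have gc': "continuous_on UNIV (\<lambda>x. complex_of_real (g x))" by (intro continuous_intros)
  define \<psi> where "\<psi> = isotypic_average L p (\<lambda>x. complex_of_real (g x))"
  show ?thesis
  proof (rule that[of p \<psi>])
    show "p \<ge> 1" by fact
    show "continuous_on UNIV \<psi>"
      unfolding \<psi>_def by (rule isotypic_average_continuous[OF L gc'])
    show "\<psi> (L t y) = weight p t * \<psi> y" for t y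
      unfolding \<psi>_def by (rule isotypic_average_equivariant[OF L gc'])
    fix y assume y: "y \<in> S"
    define f where "f = (\<lambda>t. weight p (- t) * complex_of_real (g (L t y)))"
    have cf: "continuous_on {0..2 * pi} f" unfolding f_def
      by (intro continuous_intros continuous_on_compose2[OF gc] isometric_rep_continuous[OF L]) auto
    have Re_f: "Re (f t) = cos (of_nat p * t) * g (L t y)" for t
    proof -
      have "weight p (- t) = cis (- (of_nat p * t))"
        by (simp add: weight_def cis_conv_exp mult.assoc)
      then show ?thesis by (simp add: f_def)
    qed
    have "(f has_integral \<psi> y) {0..2 * pi}"
      using integrable_integral[OF integrable_continuous_real[OF cf]]
      by (simp add: \<psi>_def isotypic_average_def f_def)
    then have hasRe: "((\<lambda>t. Re (f t)) has_integral Re (\<psi> y)) {0..2 * pi}"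
      by (rule has_integral_Re)
    have nonneg: "Re (f t) \<ge> 0" if t: "t \<in> {0..2 * pi}" for t
    proof (cases "t \<in> B")
      case True
      then show ?thesis using \<delta>(2)[OF True y] by (simp add: Re_f g_def)
    next
      case False
      then show ?thesis using t by (simp add: Re_f B_def g_def)
    qed
    have "Re (f 0) > 0"
      using \<delta>(1) y by (simp add: Re_f g_def isometric_rep_zero[OF L])
    have "Re (\<psi> y) \<noteq> 0"
    proof
      assume "Re (\<psi> y) = 0"
      with hasRe have "((\<lambda>t. Re (f t)) has_integral 0) (cbox 0 (2 * pi))" by simp
      moreover have "continuous_on (cbox 0 (2 * pi)) (\<lambda>t. Re (f t))"
        using cf by (auto intro: continuous_intros)
      moreover have "box 0 (2 * pi) \<noteq> {}" "0 \<in> cbox 0 (2 * pi)"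
        by (simp_all add: box_real not_le)
      ultimately have "Re (f 0) = 0"
        using nonneg by (intro has_integral_0_cbox_imp_0[of 0 "2 * pi" "\<lambda>t. Re (f t)"])
          (simp_all add: box_real)
      with \<open>Re (f 0) > 0\<close> show False by simp
    qed
    then show "\<psi> y \<noteq> 0" by auto
  qed
qed

section \<open>The index and the minimax levels\<close>

text \<open>
  The condition in the definition of the index for a fixed \<open>k\<close>. In terms of this predicate
  no infimum is needed: the index is at least \<open>j\<close> iff it fails for all \<open>k < j\<close>.
\<close>
definition admits_maps :: "(real \<Rightarrow> 'a::topological_space \<Rightarrow> 'a) \<Rightarrow> 'a set \<Rightarrow> nat \<Rightarrow> bool" where
  "admits_maps L A k \<longleftrightarrow> (\<exists>n \<Phi>. n \<ge> 1 \<and>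
     (\<forall>i<k. continuous_on A (\<Phi> i)) \<and>
     (\<forall>x\<in>A. \<exists>i<k. \<Phi> i x \<noteq> 0) \<and>
     (\<forall>\<theta>. \<forall>x\<in>A. \<forall>i<k. \<Phi> i (L \<theta> x) = weight n \<theta> * \<Phi> i x))"

lemma ind_less_iff: "ind L A < enat j \<longleftrightarrow> (\<exists>k<j. admits_maps L A k)"
proof -
  have "ind L A = Inf {enat k | k. admits_maps L A k}"
    unfolding ind_def admits_maps_def weight_def by simp
  then show ?thesis by (auto simp: Inf_less_iff)
qed

lemma ind_ge_iff: "ind L A \<ge> enat j \<longleftrightarrow> (\<forall>k<j. \<not> admits_maps L A k)"
  using ind_less_iff[of L A j] by (auto simp: not_less[symmetric])

lemma admits_maps_pullback:
  assumes "admits_maps L (f ` A) k" and cont: "continuous_on A f"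
    and eq: "\<And>\<theta> x. x \<in> A \<Longrightarrow> f (L \<theta> x) = L \<theta> (f x)"
  shows "admits_maps L A k"
proof -
  obtain n \<Phi> where \<Phi>: "n \<ge> 1" "\<forall>i<k. continuous_on (f ` A) (\<Phi> i)"
    "\<forall>x\<in>f ` A. \<exists>i<k. \<Phi> i x \<noteq> 0"
    "\<forall>\<theta>. \<forall>x\<in>f ` A. \<forall>i<k. \<Phi> i (L \<theta> x) = weight n \<theta> * \<Phi> i x"
    using assms(1) unfolding admits_maps_def by blast
  show ?thesis
    unfolding admits_maps_def
  proof (rule exI[of _ n], rule exI[of _ "\<lambda>i x. \<Phi> i (f x)"], intro conjI allI impI ballI)
    show "\<exists>i<k. \<Phi> i (f x) \<noteq> 0" if "x \<in> A" for x
      using \<Phi>(3) that by blast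
    show "continuous_on A (\<lambda>x. \<Phi> i (f x))" if "i < k" for i
      using continuous_on_compose2[of "f ` A" "\<Phi> i" A f] \<Phi>(2) cont that by auto
  qed (use \<Phi> eq in auto)
qed

text \<open>
  Equivariant maps do not lower the index, as admissible maps can be pulled back. Applied to the
  proximal map, this is what replaces invariance under a deformation flow.
\<close>
lemma index_class_image:
  assumes A: "A \<in> index_class L j" and cont: "continuous_on A f"
    and eq: "\<And>\<theta> x. f (L \<theta> x) = L \<theta> (f x)"
  shows "f ` A \<in> index_class L j"
proof -
  have "L \<theta> ` f ` A = f ` L \<theta> ` A" for \<theta>
    by (simp add: image_image eq)
  moreover have "\<not> admits_maps L (f ` A) k" if "k < j" for k
    using A that admits_maps_pullback[of L f A k] cont eq by (auto simp: index_class_def ind_ge_iff)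
  ultimately show ?thesis
    using A cont by (auto simp: index_class_def ind_ge_iff invariant_set_def compact_continuous_image)
qed

lemma index_class_antimono: "i \<le> j \<Longrightarrow> index_class L j \<subseteq> index_class L i"
  by (auto simp: index_class_def ind_ge_iff)

lemma index_class_nonempty:
  assumes "A \<in> index_class L j" "j \<ge> 1"
  shows "A \<noteq> {}"
proof
  assume "A = {}"
  then have "admits_maps L A 0"
    unfolding admits_maps_def by (intro exI[of _ 1]) auto
  with assms show False by (auto simp: index_class_def ind_ge_iff)
qed

text \<open>
  The real and imaginary parts are extended separately by the Tietze theorem for normal spaces, which
  applies to every metric space and so to Hilbert spaces that need not be separable.
\<close>
lemma Tietze_complex:
  fixes f :: "'a::metric_space \<Rightarrow> complex"
  assumes "closed S" "continuous_on S f"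
  obtains g where "continuous_on UNIV g" "\<And>x. x \<in> S \<Longrightarrow> g x = f x"
proof -
  have norm: "normal_space (euclidean :: 'a topology)"
    by (simp add: metrizable_imp_normal_space metrizable_space_euclidean)
  have ext: "\<exists>g. continuous_on UNIV g \<and> (\<forall>x\<in>S. g x = u x)"
    if "continuous_on S u" for u :: "'a \<Rightarrow> real"
  proof -
    have "continuous_map (top_of_set S) euclideanreal u" using that by simp
    moreover have "closedin euclidean S" using \<open>closed S\<close> by simp
    ultimately obtain g where "continuous_map euclidean euclideanreal g" "\<And>x. x \<in> S \<Longrightarrow> g x = u x"
      using Tietze_extension_realinterval[OF norm, of S UNIV u] by auto
    then show ?thesis by auto
  qed
  obtain a where a: "continuous_on UNIV a" "\<And>x. x \<in> S \<Longrightarrow> a x = Re (f x)"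
    using ext[of "\<lambda>x. Re (f x)"] assms(2) by (auto intro: continuous_intros)
  obtain b where b: "continuous_on UNIV b" "\<And>x. x \<in> S \<Longrightarrow> b x = Im (f x)"
    using ext[of "\<lambda>x. Im (f x)"] assms(2) by (auto intro: continuous_intros)
  show ?thesis
  proof (rule that)
    show "continuous_on UNIV (\<lambda>x. Complex (a x) (b x))"
      using a(1) b(1) by (auto simp: Complex_eq intro!: continuous_intros)
  qed (simp add: a(2) b(2))
qed

text \<open>
  Subadditivity of the index, in the case where one of the two pieces is \<open>{\<psi> \<noteq> 0}\<close> for a scalar
  equivariant \<open>\<psi>\<close>. The components on the zero set \<open>B\<close> of \<open>\<psi>\<close> are extended to the whole space
  and made equivariant again by averaging, which multiplies them by \<open>2\<pi>\<close> on \<open>B\<close>; adjoining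
  \<open>\<psi>\<close> as a further component removes the zeros outside \<open>B\<close>. The weights \<open>n\<close> and \<open>p\<close> are
  brought to the common value \<open>n p\<close> by taking powers.
\<close>
lemma admits_maps_Suc:
  fixes L :: "real \<Rightarrow> 'a::real_normed_vector \<Rightarrow> 'a"
  assumes L: "isometric_rep L" and "closed A" and inv: "invariant_set L A"
    and \<psi>: "continuous_on UNIV \<psi>" "p \<ge> 1" "\<And>t x. \<psi> (L t x) = weight p t * \<psi> x"
    and "admits_maps L {x \<in> A. \<psi> x = 0} k"
  shows "admits_maps L A (Suc k)"
proof -
  define B where "B = {x \<in> A. \<psi> x = 0}"
  have clB: "closed B"
    unfolding B_def using \<open>closed A\<close> \<psi>(1)
    by (intro continuous_closed_preimage_constant) (auto intro: continuous_on_subset)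
  have invB: "L t x \<in> B" if "x \<in> B" for t x
    using that inv by (auto simp: B_def \<psi>(3) invariant_set_def)
  obtain n \<Phi> where \<Phi>: "n \<ge> 1" "\<forall>i<k. continuous_on B (\<Phi> i)"
    "\<forall>x\<in>B. \<exists>i<k. \<Phi> i x \<noteq> 0"
    "\<forall>\<theta>. \<forall>x\<in>B. \<forall>i<k. \<Phi> i (L \<theta> x) = weight n \<theta> * \<Phi> i x"
    using assms(7) unfolding admits_maps_def B_def by blast
  have "\<forall>i. \<exists>g. i < k \<longrightarrow> continuous_on UNIV g \<and> (\<forall>x\<in>B. g x = \<Phi> i x)"
    using \<Phi>(2) Tietze_complex[OF clB] by metis
  then obtain g where g: "\<And>i. i < k \<Longrightarrow> continuous_on UNIV (g i)"
    "\<And>i x. i < k \<Longrightarrow> x \<in> B \<Longrightarrow> g i x = \<Phi> i x"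
    by metis
  define G where "G = (\<lambda>i. isotypic_average L n (g i))"
  have G_B: "G i x = 2 * pi * \<Phi> i x" if "i < k" "x \<in> B" for i x
  proof -
    have "weight n (- \<theta>) * g i (L \<theta> x) = \<Phi> i x" for \<theta>
    proof -
      have "weight n (- \<theta>) * g i (L \<theta> x) = (weight n (- \<theta>) * weight n \<theta>) * \<Phi> i x"
        using that g(2) invB \<Phi>(4) by (simp add: mult.assoc)
      also have "weight n (- \<theta>) * weight n \<theta> = 1"
        by (simp add: weight_zero flip: weight_add)
      finally show ?thesis by simp
    qed
    then show ?thesis by (simp add: G_def isotypic_average_def scaleR_conv_of_real)
  qed
  have G_cont: "continuous_on A (G i)" if "i < k" for i
    using isotypic_average_continuous[OF L g(1)[OF that]] unfolding G_def
    by (rule continuous_on_subset) simp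
  have \<psi>_cont: "continuous_on A \<psi>" using \<psi>(1) by (rule continuous_on_subset) simp
  have G_eq: "G i (L t x) = weight n t * G i x" if "i < k" for i t x
    unfolding G_def by (rule isotypic_average_equivariant[OF L g(1)[OF that]])
  define \<Psi> where "\<Psi> = (\<lambda>i x. if i < k then G i x ^ p else \<psi> x ^ n)"
  show ?thesis
    unfolding admits_maps_def
  proof (rule exI[of _ "n * p"], rule exI[of _ \<Psi>], intro conjI allI impI ballI)
    show "n * p \<ge> 1" using \<Phi>(1) \<psi>(2) by simp
    show "continuous_on A (\<Psi> i)" if "i < Suc k" for i
      using G_cont[of i] \<psi>_cont by (cases "i < k") (auto simp: \<Psi>_def intro: continuous_intros)
    show "\<Psi> i (L t x) = weight (n * p) t * \<Psi> i x" for t x i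
      using G_eq[of i t x] \<psi>(3)[of t x]
      by (simp add: \<Psi>_def power_mult_distrib weight_power mult.commute)
    show "\<exists>i<Suc k. \<Psi> i x \<noteq> 0" if "x \<in> A" for x
    proof (cases "\<psi> x = 0")
      case True
      then have "x \<in> B" using that by (simp add: B_def)
      then obtain i where "i < k" "\<Phi> i x \<noteq> 0" using \<Phi>(3) by blast
      then show ?thesis
        using G_B[OF \<open>i < k\<close> \<open>x \<in> B\<close>] by (intro exI[of _ i]) (auto simp: \<Psi>_def)
    next
      case False
      then show ?thesis by (intro exI[of _ k]) (auto simp: \<Psi>_def)
    qed
  qed
qed

lemma index_class_remove:
  fixes L :: "real \<Rightarrow> 'a::real_normed_vector \<Rightarrow> 'a"
  assumes L: "isometric_rep L" and A: "A \<in> index_class L k" and "j < k"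
    and \<psi>: "continuous_on UNIV \<psi>" "p \<ge> 1" "\<And>t x. \<psi> (L t x) = weight p t * \<psi> x"
  shows "{x \<in> A. \<psi> x = 0} \<in> index_class L j"
proof -
  let ?B = "{x \<in> A. \<psi> x = 0}"
  have A': "compact A" "invariant_set L A" "\<And>i. i < k \<Longrightarrow> \<not> admits_maps L A i"
    using A by (auto simp: index_class_def ind_ge_iff)
  have "compact ?B"
  proof -
    have "closed ?B"
      using compact_imp_closed[OF A'(1)] \<psi>(1)
      by (intro continuous_closed_preimage_constant) (auto intro: continuous_on_subset)
    then have "compact (A \<inter> ?B)" using A'(1) by (rule compact_Int_closed[rotated])
    then show ?thesis by (simp add: Int_absorb1)
  qed
  moreover have "invariant_set L ?B"
  proof -
    have sub: "L t ` ?B \<subseteq> ?B" for t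
      using A'(2) by (auto simp: \<psi>(3) invariant_set_def)
    have "x \<in> L t ` ?B" if "x \<in> ?B" for t x
    proof
      show "x = L t (L (- t) x)" using isometric_rep_inverse[OF L, of "- t" x] by simp
      show "L (- t) x \<in> ?B" using sub[of "- t"] that by blast
    qed
    with sub show ?thesis unfolding invariant_set_def by blast
  qed
  moreover have "\<not> admits_maps L ?B i" if "i < j" for i
  proof
    assume "admits_maps L ?B i"
    from admits_maps_Suc[OF L compact_imp_closed[OF A'(1)] A'(2) \<psi> this]
    show False using A'(3)[of "Suc i"] that \<open>j < k\<close> by simp
  qed
  ultimately show ?thesis by (simp add: index_class_def ind_ge_iff)
qed

lemma minimax_level_mono: "i \<le> j \<Longrightarrow> minimax_level L G i \<le> minimax_level L G j"
  unfolding minimax_level_def by (intro INF_superset_mono index_class_antimono) auto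

lemma minimax_level_approx:
  assumes "minimax_level L G j = ereal c" "e > 0"
  obtains A where "A \<in> index_class L j" "\<And>x. x \<in> A \<Longrightarrow> G x < c + e"
proof -
  have "minimax_level L G j < ereal (c + e)" using assms by simp
  then obtain A where A: "A \<in> index_class L j" "(SUP x\<in>A. ereal (G x)) < ereal (c + e)"
    unfolding minimax_level_def INF_less_iff by blast
  have "G x < c + e" if "x \<in> A" for x
  proof -
    have "ereal (G x) \<le> (SUP x\<in>A. ereal (G x))" using that by (rule SUP_upper)
    with A(2) show ?thesis by (metis ereal_less_eq(3) le_less_trans less_ereal.simps(1))
  qed
  with A(1) that show thesis by blast
qed

text \<open>The image of \<open>A\<close> under \<open>f\<close> competes in the infimum, so \<open>G\<close> cannot be below \<open>c - e\<close> on all of it.\<close>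
lemma minimax_level_linking:
  assumes "minimax_level L G j = ereal c" "e > 0" and A: "A \<in> index_class L j"
    and "continuous_on A f" "\<And>\<theta> x. f (L \<theta> x) = L \<theta> (f x)"
  obtains x where "x \<in> A" "c - e < G (f x)"
proof -
  have "f ` A \<in> index_class L j" using index_class_image A assms(4,5) by blast
  then have "ereal c \<le> (SUP x\<in>f ` A. ereal (G x))"
    unfolding assms(1)[symmetric] minimax_level_def by (rule INF_lower)
  moreover have "ereal (c - e) < ereal c" using \<open>e > 0\<close> by simp
  ultimately have "ereal (c - e) < (SUP x\<in>f ` A. ereal (G x))" by (rule less_le_trans[rotated])
  then show thesis using that by (auto simp: less_SUP_iff)
qed

section \<open>The proximal map of a weakly convex functional\<close>

text \<open>
  This identity turns the convexity of \<open>I + \<alpha>\<parallel>.\<parallel>\<^sup>2\<close> into a lower bound for the convexity of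
  \<open>I + \<parallel>. - q\<parallel>\<^sup>2/\<epsilon>\<close>, uniformly in the centre \<open>q\<close>.
\<close>
lemma norm_segment_identity:
  fixes a b q :: "'a::real_inner"
  shows "(norm ((1 - t) *\<^sub>R a + t *\<^sub>R b - q))\<^sup>2 =
    (1 - t) * (norm (a - q))\<^sup>2 + t * (norm (b - q))\<^sup>2 - t * (1 - t) * (norm (a - b))\<^sup>2"
  unfolding power2_norm_eq_inner
  by (simp add: inner_simps inner_commute algebra_simps power2_eq_square)

locale weakly_convex =
  fixes T :: "'x::{real_inner, complete_space} \<Rightarrow> ereal" and \<alpha> \<epsilon> m :: real
  assumes eps: "0 < \<epsilon>" "\<epsilon> < inverse \<alpha>" "0 < \<alpha>"
    and bounded_below: "ereal m \<le> T x"
    and proper: "edom T \<noteq> {}"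
    and lsc: "a < T x \<Longrightarrow> eventually (\<lambda>y. a < T y) (nhds x)"
    and convex: "convex_on (edom T) (\<lambda>q. real_of_ereal (T q) + \<alpha> * (norm q)\<^sup>2)"
begin

definition fval :: "'x \<Rightarrow> real" where "fval x = real_of_ereal (T x)"

text \<open>The modulus of strong convexity of all the functions \<open>penalized q\<close>.\<close>
definition \<kappa> :: real where "\<kappa> = inverse \<epsilon> - \<alpha>"

definition penalized :: "'x \<Rightarrow> 'x \<Rightarrow> real" where "penalized q x = inverse \<epsilon> * (norm (x - q))\<^sup>2 + fval x"

lemma kappa_pos: "\<kappa> > 0"
  using eps by (simp add: \<kappa>_def field_simps)

lemma T_eq: "x \<in> edom T \<Longrightarrow> T x = ereal (fval x)"
  using bounded_below[of x] by (cases "T x") (auto simp: fval_def edom_def)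

lemma fval_bounded: "x \<in> edom T \<Longrightarrow> m \<le> fval x"
  using bounded_below[of x] T_eq by simp

lemma penalized_ge: "x \<in> edom T \<Longrightarrow> m \<le> penalized q x"
  using fval_bounded[of x] eps(1) unfolding penalized_def
  by (smt (verit) mult_nonneg_nonneg inverse_nonnegative_iff_nonnegative zero_le_power2)

lemma segment_in_domain:
  "\<lbrakk>x \<in> edom T; y \<in> edom T; 0 \<le> t; t \<le> 1\<rbrakk> \<Longrightarrow> (1 - t) *\<^sub>R x + t *\<^sub>R y \<in> edom T"
  using convex convex_alt[of "edom T"] by (simp add: convex_on_def)

lemma penalized_strongly_convex:
  assumes "x \<in> edom T" "y \<in> edom T" "0 \<le> t" "t \<le> 1"
  shows "penalized q ((1 - t) *\<^sub>R x + t *\<^sub>R y) \<le>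
    (1 - t) * penalized q x + t * penalized q y - \<kappa> * (t * (1 - t) * (norm (x - y))\<^sup>2)"
proof -
  define z where "z = (1 - t) *\<^sub>R x + t *\<^sub>R y"
  have "fval z + \<alpha> * (norm z)\<^sup>2 \<le> (1 - t) * (fval x + \<alpha> * (norm x)\<^sup>2) + t * (fval y + \<alpha> * (norm y)\<^sup>2)"
    using convex_onD[OF convex, of t x y] assms by (simp add: fval_def z_def)
  moreover have "(norm z)\<^sup>2 = (1 - t) * (norm x)\<^sup>2 + t * (norm y)\<^sup>2 - t * (1 - t) * (norm (x - y))\<^sup>2"
    using norm_segment_identity[of t x y 0] by (simp add: z_def)
  ultimately have "fval z \<le> (1 - t) * fval x + t * fval y + \<alpha> * (t * (1 - t) * (norm (x - y))\<^sup>2)"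
    by (simp add: algebra_simps)
  then show ?thesis
    unfolding penalized_def z_def[symmetric] \<kappa>_def
    unfolding z_def norm_segment_identity by (simp add: algebra_simps)
qed

lemma penalized_midpoint:
  assumes "x \<in> edom T" "y \<in> edom T"
  obtains z where "z \<in> edom T" "penalized q z \<le> (penalized q x + penalized q y) / 2 - \<kappa> * (norm (x - y))\<^sup>2 / 4"
proof (rule that)
  show "(1 - 1/2) *\<^sub>R x + (1/2) *\<^sub>R y \<in> edom T"
    using segment_in_domain[OF assms, of "1/2"] by simp
  show "penalized q ((1 - 1/2) *\<^sub>R x + (1/2) *\<^sub>R y) \<le> (penalized q x + penalized q y) / 2 - \<kappa> * (norm (x - y))\<^sup>2 / 4"
    using penalized_strongly_convex[OF assms, of "1/2" q] by (simp add: field_simps)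
qed

definition is_minimizer :: "'x \<Rightarrow> 'x \<Rightarrow> bool" where
  "is_minimizer q p \<longleftrightarrow> p \<in> edom T \<and> (\<forall>x\<in>edom T. penalized q p \<le> penalized q x)"

text \<open>
  Compare \<open>p\<close> with the midpoint of \<open>x\<close> and \<open>p\<close>, where strong convexity gains a quarter of
  \<open>\<kappa> \<parallel>x - p\<parallel>\<^sup>2\<close>.
\<close>
lemma minimizer_growth:
  assumes "is_minimizer q p" "x \<in> edom T"
  shows "penalized q p + \<kappa> * (norm (x - p))\<^sup>2 / 2 \<le> penalized q x"
proof -
  obtain z where z: "z \<in> edom T" "penalized q z \<le> (penalized q x + penalized q p) / 2 - \<kappa> * (norm (x - p))\<^sup>2 / 4"
    using penalized_midpoint[of x p q] assms by (auto simp: is_minimizer_def)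
  have "penalized q p \<le> penalized q z" using assms z by (simp add: is_minimizer_def)
  with z(2) show ?thesis by argo
qed

lemma minimizer_unique:
  assumes "is_minimizer q p" "is_minimizer q p'"
  shows "p' = p"
proof -
  have "penalized q p' \<le> penalized q p" using assms by (simp add: is_minimizer_def)
  moreover have "penalized q p + \<kappa> * (norm (p' - p))\<^sup>2 / 2 \<le> penalized q p'"
    using minimizer_growth assms by (simp add: is_minimizer_def)
  ultimately have "\<kappa> * (norm (p' - p))\<^sup>2 / 2 \<le> 0" by simp
  with kappa_pos show ?thesis by (simp add: mult_le_0_iff)
qed

text \<open>
  Strong convexity makes every minimizing sequence Cauchy: the midpoint of two almost minimal points
  would otherwise lie below the infimum. The limit is a minimizer by lower semicontinuity.
\<close>
lemma minimizer_exists: "\<exists>p. is_minimizer q p"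
proof -
  define s where "s = Inf (penalized q ` edom T)"
  have bdd: "bdd_below (penalized q ` edom T)" using penalized_ge by (intro bdd_belowI2)
  have s_le: "s \<le> penalized q x" if "x \<in> edom T" for x
    unfolding s_def using that bdd by (simp add: cInf_lower)
  have "\<exists>x\<in>edom T. penalized q x < s + 1 / real (Suc n)" for n
  proof -
    have "Inf (penalized q ` edom T) < s + 1 / real (Suc n)" by (simp add: s_def)
    from cInf_lessD[OF _ this] proper show ?thesis by auto
  qed
  then obtain X where X: "\<And>n. X n \<in> edom T" "\<And>n. penalized q (X n) < s + 1 / real (Suc n)"
    by metis
  have near: "\<kappa> * (norm (X i - X j))\<^sup>2 \<le> 4 * (1 / real (Suc n))" if "i \<ge> n" "j \<ge> n" for i j n
  proof -
    obtain z where z: "z \<in> edom T"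
      "penalized q z \<le> (penalized q (X i) + penalized q (X j)) / 2 - \<kappa> * (norm (X i - X j))\<^sup>2 / 4"
      using penalized_midpoint[OF X(1) X(1)] by blast
    define u where "u = 1 / real (Suc n)"
    have "1 / real (Suc i) \<le> u" "1 / real (Suc j) \<le> u"
      unfolding u_def using that by (auto intro!: frac_le)
    then have "penalized q (X i) < s + u" "penalized q (X j) < s + u"
      using X(2)[of i] X(2)[of j] by linarith+
    with z(2) s_le[OF z(1)] show ?thesis unfolding u_def[symmetric] by argo
  qed
  have "Cauchy X"
  proof (rule CauchyI)
    fix e :: real assume "e > 0"
    have "\<kappa> * e\<^sup>2 / 4 > 0" using \<open>e > 0\<close> kappa_pos by simp
    then obtain n where n: "inverse (real (Suc n)) < \<kappa> * e\<^sup>2 / 4" using reals_Archimedean by blast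
    have "norm (X i - X j) < e" if "i \<ge> n" "j \<ge> n" for i j
    proof -
      have "\<kappa> * (norm (X i - X j))\<^sup>2 < \<kappa> * e\<^sup>2"
        using near[OF that] n unfolding inverse_eq_divide by argo
      then have "(norm (X i - X j))\<^sup>2 < e\<^sup>2"
        using kappa_pos by (simp add: mult_less_cancel_left_pos)
      then show ?thesis
        by (rule power2_less_imp_less) (use \<open>e > 0\<close> in simp)
    qed
    then show "\<exists>M. \<forall>i\<ge>M. \<forall>j\<ge>M. norm (X i - X j) < e" by blast
  qed
  then obtain p where p: "X \<longlonglongrightarrow> p" unfolding Cauchy_convergent_iff convergent_def by blast
  \<comment> \<open>the value of the functional at \<open>p\<close> for which \<open>penalized q p\<close> equals the infimum \<open>s\<close>\<close>
  define a where "a = s - inverse \<epsilon> * (norm (p - q))\<^sup>2"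
  have T_p: "T p \<le> ereal a"
  proof (rule ccontr)
    assume "\<not> T p \<le> ereal a"
    then obtain b where b: "ereal a < ereal b" "ereal b < T p"
      using ereal_dense2[of "ereal a" "T p"] by (auto simp: not_le)
    have "eventually (\<lambda>n. ereal b < T (X n)) sequentially"
      using eventually_compose_filterlim[OF lsc[OF b(2)] p] .
    then have ev: "eventually (\<lambda>n. b \<le> s + 1 / real (Suc n) - inverse \<epsilon> * (norm (X n - q))\<^sup>2) sequentially"
    proof eventually_elim
      case (elim n)
      then have "b < fval (X n)" using T_eq[OF X(1)] by simp
      with X(2)[of n] show ?case by (simp add: penalized_def)
    qed
    have "(\<lambda>n. s + 1 / real (Suc n) - inverse \<epsilon> * (norm (X n - q))\<^sup>2) \<longlonglongrightarrow>
        s + 0 - inverse \<epsilon> * (norm (p - q))\<^sup>2"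
      by (intro tendsto_intros p LIMSEQ_Suc[OF lim_1_over_n])
    from tendsto_lowerbound[OF this ev] b(1) show False by (simp add: a_def)
  qed
  then have pD: "p \<in> edom T" by (auto simp: edom_def)
  have "penalized q p \<le> s" using T_p T_eq[OF pD] by (simp add: penalized_def a_def)
  then have "is_minimizer q p"
    using pD s_le by (force simp: is_minimizer_def)
  then show ?thesis by blast
qed

definition prox :: "'x \<Rightarrow> 'x" where "prox q = (THE p. is_minimizer q p)"

lemma prox_minimizer: "is_minimizer q (prox q)"
  unfolding prox_def using minimizer_exists minimizer_unique by (metis the_equality)

lemma prox_eqI: "is_minimizer q p \<Longrightarrow> prox q = p"
  using minimizer_unique prox_minimizer by blast

lemma prox_in_domain: "prox q \<in> edom T"
  using prox_minimizer is_minimizer_def by blast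

lemma prox_le: "x \<in> edom T \<Longrightarrow> penalized q (prox q) \<le> penalized q x"
  using prox_minimizer is_minimizer_def by blast

text \<open>
  Add the growth inequalities of the two minimizers, each tested at the other one. The values of the
  functional cancel, and what remains of the squared norms is \<open>2 (p - p') \<bullet> (q - q')\<close>.
\<close>
lemma prox_lipschitz: "norm (prox q - prox q') \<le> 2 * inverse \<epsilon> / \<kappa> * norm (q - q')"
proof -
  define p p' where pp: "p = prox q" "p' = prox q'"
  have "penalized q p + \<kappa> * (norm (p' - p))\<^sup>2 / 2 \<le> penalized q p'"
    "penalized q' p' + \<kappa> * (norm (p - p'))\<^sup>2 / 2 \<le> penalized q' p"
    unfolding pp by (intro minimizer_growth prox_minimizer prox_in_domain)+
  then have "\<kappa> * (norm (p - p'))\<^sup>2 \<le>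
      inverse \<epsilon> * ((norm (p' - q))\<^sup>2 - (norm (p - q))\<^sup>2 + (norm (p - q'))\<^sup>2 - (norm (p' - q'))\<^sup>2)"
    by (simp add: penalized_def norm_minus_commute algebra_simps)
  also have "(norm (p' - q))\<^sup>2 - (norm (p - q))\<^sup>2 + (norm (p - q'))\<^sup>2 - (norm (p' - q'))\<^sup>2
      = 2 * ((p - p') \<bullet> (q - q'))"
    unfolding power2_norm_eq_inner by (simp add: inner_simps inner_commute algebra_simps)
  also have "inverse \<epsilon> * (2 * ((p - p') \<bullet> (q - q'))) \<le> inverse \<epsilon> * (2 * (norm (p - p') * norm (q - q')))"
    using eps(1) by (intro mult_left_mono norm_cauchy_schwarz) auto
  finally have *: "norm (p - p') * (\<kappa> * norm (p - p')) \<le> norm (p - p') * (2 * inverse \<epsilon> * norm (q - q'))"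
    by (simp add: power2_eq_square algebra_simps)
  have "\<kappa> * norm (p - p') \<le> 2 * inverse \<epsilon> * norm (q - q')"
  proof (cases "norm (p - p') = 0")
    case True
    then show ?thesis using eps(1) by simp
  next
    case False
    then show ?thesis using * by (simp add: mult_le_cancel_left)
  qed
  then show ?thesis
    unfolding pp[symmetric] using kappa_pos by (simp add: pos_le_divide_eq mult.commute)
qed

lemma prox_continuous: "continuous_on S prox"
proof (rule continuous_on_subset[of UNIV])
  show "continuous_on UNIV prox"
    by (rule lipschitz_on_continuous_on[of "2 * inverse \<epsilon> / \<kappa>"], rule lipschitz_onI)
      (use prox_lipschitz eps(1) kappa_pos in \<open>auto simp: dist_norm\<close>)
qed simp

lemma prox_equivariant:
  assumes T: "\<And>x. T (U x) = T x" and iso: "\<And>x y. norm (U x - U y) = norm (x - y)"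
    and "surj U"
  shows "prox (U q) = U (prox q)"
proof (rule prox_eqI)
  have dom: "U x \<in> edom T \<longleftrightarrow> x \<in> edom T" for x by (simp add: edom_def T)
  have penalized: "penalized (U q) (U x) = penalized q x" for x by (simp add: penalized_def fval_def T iso)
  show "is_minimizer (U q) (U (prox q))"
    unfolding is_minimizer_def
  proof (intro conjI ballI)
    fix x assume "x \<in> edom T"
    moreover obtain y where "x = U y" using \<open>surj U\<close> by blast
    ultimately show "penalized (U q) (U (prox q)) \<le> penalized (U q) x"
      using prox_le dom penalized by auto
  qed (simp add: dom prox_in_domain)
qed

definition envelope :: "'x \<Rightarrow> real" where
  "envelope q = real_of_ereal (INF x. ereal (inverse \<epsilon> * (norm (x - q))\<^sup>2) + T x)"

lemma envelope_eq: "envelope q = penalized q (prox q)"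
proof -
  have eq: "ereal (inverse \<epsilon> * (norm (x - q))\<^sup>2) + T x = ereal (penalized q x)" if "x \<in> edom T" for x
    using T_eq[OF that] by (simp add: penalized_def)
  have "(INF x. ereal (inverse \<epsilon> * (norm (x - q))\<^sup>2) + T x) = ereal (penalized q (prox q))"
  proof (rule antisym)
    show "(INF x. ereal (inverse \<epsilon> * (norm (x - q))\<^sup>2) + T x) \<le> ereal (penalized q (prox q))"
      unfolding eq[OF prox_in_domain, symmetric] by (rule INF_lower) simp
    show "ereal (penalized q (prox q)) \<le> (INF x. ereal (inverse \<epsilon> * (norm (x - q))\<^sup>2) + T x)"
    proof (rule INF_greatest)
      fix x
      show "ereal (penalized q (prox q)) \<le> ereal (inverse \<epsilon> * (norm (x - q))\<^sup>2) + T x"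
      proof (cases "x \<in> edom T")
        case True
        then show ?thesis using prox_le eq by simp
      next
        case False
        then have "T x = \<infinity>" by (simp add: edom_def)
        then show ?thesis by simp
      qed
    qed
  qed
  then show ?thesis by (simp add: envelope_def)
qed

lemma envelope_prox: "envelope q = inverse \<epsilon> * (norm (prox q - q))\<^sup>2 + fval (prox q)"
  by (simp add: envelope_eq penalized_def)

lemma envelope_le: "x \<in> edom T \<Longrightarrow> envelope q \<le> inverse \<epsilon> * (norm (x - q))\<^sup>2 + fval x"
  unfolding envelope_eq using prox_le by (simp add: penalized_def)

lemma envelope_ge: "m \<le> envelope q"
  unfolding envelope_eq by (intro penalized_ge prox_in_domain)

lemma envelope_prox_le: "envelope (prox q) \<le> fval (prox q)"
  using envelope_le[OF prox_in_domain, of "prox q" q] by simp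

text \<open>
  If \<open>prox q \<noteq> q\<close>, testing the infimum with \<open>prox q\<close> shows that the envelope falls at a linear rate
  on the segment from \<open>q\<close> to \<open>prox q\<close>. If \<open>prox q = q\<close>, testing with \<open>q\<close> and with \<open>prox y\<close>
  bounds the increment between \<open>q\<close> and \<open>y\<close> by a multiple of \<open>\<parallel>y - q\<parallel>\<^sup>2\<close>.
\<close>
lemma envelope_stationary_iff: "(envelope has_derivative (\<lambda>_. 0)) (at q) \<longleftrightarrow> prox q = q"
proof
  assume der: "(envelope has_derivative (\<lambda>_. 0)) (at q)"
  define v where "v = prox q - q"
  define D where "D = (norm v)\<^sup>2"
  have le: "envelope (q + t *\<^sub>R v) - envelope q \<le> inverse \<epsilon> * (- 2 * t + t\<^sup>2) * D" for t
  proof -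
    have "prox q - (q + t *\<^sub>R v) = (1 - t) *\<^sub>R v" by (simp add: v_def algebra_simps)
    then have "(norm (prox q - (q + t *\<^sub>R v)))\<^sup>2 = (1 - t)\<^sup>2 * D"
      by (simp add: D_def power_mult_distrib)
    then have "envelope (q + t *\<^sub>R v) \<le> inverse \<epsilon> * ((1 - t)\<^sup>2 * D) + fval (prox q)"
      using envelope_le[OF prox_in_domain, of "q + t *\<^sub>R v" q] by simp
    moreover have "envelope q = inverse \<epsilon> * D + fval (prox q)"
      by (simp add: envelope_prox D_def v_def)
    ultimately show ?thesis
      by (simp add: power2_eq_square algebra_simps)
  qed
  have "((\<lambda>t. envelope (q + t *\<^sub>R v)) has_derivative (\<lambda>_. 0)) (at (0::real))"
  proof -
    have "((\<lambda>t. q + t *\<^sub>R v) has_derivative (\<lambda>t. t *\<^sub>R v)) (at (0::real))"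
      by (auto intro!: derivative_eq_intros)
    from has_derivative_compose[OF this, of envelope "\<lambda>_. 0"] der show ?thesis by simp
  qed
  then have "((\<lambda>t. envelope (q + t *\<^sub>R v)) has_real_derivative 0) (at 0)"
    unfolding has_field_derivative_def by (simp only: lambda_zero)
  then have "((\<lambda>t. (envelope (q + t *\<^sub>R v) - envelope q) / t) \<longlongrightarrow> 0) (at 0)"
    by (simp add: DERIV_def)
  then have lim: "((\<lambda>t. (envelope (q + t *\<^sub>R v) - envelope q) / t) \<longlongrightarrow> 0) (at_right 0)"
    by (rule tendsto_within_subset) simp
  have "eventually (\<lambda>t::real. t > 0) (at_right 0)" by (simp add: eventually_at_right_less)
  then have ev: "eventually (\<lambda>t. (envelope (q + t *\<^sub>R v) - envelope q) / t \<le> inverse \<epsilon> * (- 2 + t) * D) (at_right 0)"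
  proof eventually_elim
    case (elim t)
    then show ?case
      using le[of t] by (simp add: field_simps power2_eq_square)
  qed
  have lim2: "((\<lambda>t. inverse \<epsilon> * (- 2 + t) * D) \<longlongrightarrow> inverse \<epsilon> * (- 2 + 0) * D) (at_right 0)"
    by (intro tendsto_intros)
  have "0 \<le> inverse \<epsilon> * (- 2 + 0) * D"
    by (rule tendsto_le[OF _ lim2 lim ev]) simp
  then have "D \<le> 0" using eps(1) by (simp add: field_simps)
  then show "prox q = q" by (simp add: D_def v_def)
next
  assume fixed: "prox q = q"
  \<comment> \<open>the Lipschitz constant of \<open>prox\<close>\<close>
  define K where "K = 2 * inverse \<epsilon> / \<kappa>"
  have qD: "q \<in> edom T" using prox_in_domain[of q] fixed by simp
  have bound: "norm (envelope y - envelope q) \<le> inverse \<epsilon> * (1 + 2 * K) * (norm (y - q))\<^sup>2" for y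
  proof -
    have up: "envelope y \<le> envelope q + inverse \<epsilon> * (norm (y - q))\<^sup>2"
      using envelope_le[OF qD, of y] envelope_prox[of q] fixed by (simp add: norm_minus_commute)
    define a where "a = prox y - q"
    define b where "b = y - q"
    have "norm a \<le> K * norm b"
      using prox_lipschitz[of y q] fixed by (simp add: K_def a_def b_def)
    have envelope_q: "envelope q \<le> inverse \<epsilon> * (norm a)\<^sup>2 + fval (prox y)"
      using envelope_le[OF prox_in_domain, of q y] by (simp add: a_def)
    have "(norm (prox y - y))\<^sup>2 = (norm a)\<^sup>2 - 2 * (a \<bullet> b) + (norm b)\<^sup>2"
    proof -
      have "prox y - y = a - b" by (simp add: a_def b_def)
      then show ?thesis
        unfolding power2_norm_eq_inner by (simp add: inner_simps inner_commute)
    qed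
    then have envelope_y: "envelope y = inverse \<epsilon> * ((norm a)\<^sup>2 - 2 * (a \<bullet> b) + (norm b)\<^sup>2) + fval (prox y)"
      by (simp only: envelope_prox[of y])
    have "envelope q - envelope y \<le> inverse \<epsilon> * (2 * (a \<bullet> b) - (norm b)\<^sup>2)"
      using envelope_q unfolding envelope_y by (simp add: algebra_simps)
    also have "\<dots> \<le> inverse \<epsilon> * (2 * K * (norm b)\<^sup>2)"
    proof (rule mult_left_mono)
      have "a \<bullet> b \<le> norm a * norm b" by (rule norm_cauchy_schwarz)
      also have "\<dots> \<le> K * norm b * norm b"
        using \<open>norm a \<le> K * norm b\<close> by (intro mult_right_mono) auto
      finally have "a \<bullet> b \<le> K * (norm b)\<^sup>2" by (simp add: power2_eq_square mult.assoc)
      moreover have "0 \<le> (norm b)\<^sup>2" by simp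
      ultimately show "2 * (a \<bullet> b) - (norm b)\<^sup>2 \<le> 2 * K * (norm b)\<^sup>2" by linarith
    qed (use eps(1) in simp)
    finally have low: "envelope q - envelope y \<le> inverse \<epsilon> * (2 * K * (norm (y - q))\<^sup>2)"
      by (simp add: b_def)
    have "K \<ge> 0" using eps(1) kappa_pos by (simp add: K_def)
    then have "0 \<le> inverse \<epsilon> * (2 * K * (norm (y - q))\<^sup>2)" "0 \<le> inverse \<epsilon> * (norm (y - q))\<^sup>2"
      using eps(1) by simp_all
    moreover have "inverse \<epsilon> * (1 + 2 * K) * (norm (y - q))\<^sup>2 =
        inverse \<epsilon> * (norm (y - q))\<^sup>2 + inverse \<epsilon> * (2 * K * (norm (y - q))\<^sup>2)"
      by (simp only: distrib_left distrib_right mult.assoc mult_1_right mult_1_left)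
    ultimately show ?thesis using up low by (simp only: real_norm_def abs_le_iff) linarith
  qed
  define C where "C = inverse \<epsilon> * (1 + 2 * K)"
  have C: "C > 0"
  proof -
    have "K \<ge> 0" using eps(1) kappa_pos by (simp add: K_def)
    then show ?thesis using eps(1) unfolding C_def by (intro mult_pos_pos) auto
  qed
  show "(envelope has_derivative (\<lambda>_. 0)) (at q)"
    unfolding has_derivative_within_alt
  proof (intro conjI allI impI)
    show "bounded_linear (\<lambda>_::'x. 0::real)" by (rule bounded_linear_zero)
    fix e :: real assume "e > 0"
    have "norm (envelope y - envelope q - 0) \<le> e * norm (y - q)" if "norm (y - q) < e / C" for y
    proof -
      have "norm (envelope y - envelope q - 0) \<le> (C * norm (y - q)) * norm (y - q)"
        using bound[of y] by (simp only: C_def power2_eq_square mult.assoc diff_zero)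
      also have "\<dots> \<le> e * norm (y - q)"
        using that C by (intro mult_right_mono) (auto simp: pos_less_divide_eq mult.commute)
      finally show ?thesis .
    qed
    moreover have "e / C > 0" using \<open>e > 0\<close> C by (rule divide_pos_pos)
    ultimately show "\<exists>d>0. \<forall>y\<in>UNIV. norm (y - q) < d \<longrightarrow> norm (envelope y - envelope q - 0) \<le> e * norm (y - q)"
      by blast
  qed
qed

end

section \<open>Critical points and Palais--Smale sequences\<close>

lemma directional_derivative_right:
  fixes F :: "'x::real_normed_vector \<Rightarrow> real"
  assumes "(F has_derivative F') (at p)"
  shows "((\<lambda>t. (F (p + t *\<^sub>R v) - F p) / t) \<longlongrightarrow> F' v) (at_right 0)"
proof -
  have lin: "F' (t *\<^sub>R v) = t * F' v" for t
    using has_derivative_linear[OF assms] by (simp add: linear_cmul)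
  have "((\<lambda>t. p + t *\<^sub>R v) has_derivative (\<lambda>t. t *\<^sub>R v)) (at (0::real))"
    by (auto intro!: derivative_eq_intros)
  from has_derivative_compose[OF this, of F F'] assms
  have "((\<lambda>t. F (p + t *\<^sub>R v)) has_derivative (\<lambda>t. F' (t *\<^sub>R v))) (at (0::real))" by simp
  then have "((\<lambda>t. F (p + t *\<^sub>R v)) has_real_derivative F' v) (at 0)"
    unfolding has_field_derivative_def lin mult_commute_abs .
  then have "((\<lambda>t. (F (p + t *\<^sub>R v) - F p) / t) \<longlongrightarrow> F' v) (at 0)"
    by (simp add: DERIV_def)
  then show ?thesis by (rule tendsto_within_subset) simp
qed

locale convex_plus_smooth =
  fixes \<Psi> :: "'x::{real_inner, complete_space} \<Rightarrow> ereal" and F :: "'x \<Rightarrow> real" and \<alpha> \<epsilon> m :: real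
  assumes eps: "0 < \<epsilon>" "\<epsilon> < inverse \<alpha>" "0 < \<alpha>"
    and C1: "C1_functional F"
    and Psi_not_MInf: "\<Psi> q \<noteq> -\<infinity>"
    and Psi_convex: "econvex \<Psi>" and Psi_lsc: "lower_semicontinuous \<Psi>"
    and Psi_proper: "edom \<Psi> \<noteq> {}"
    and bounded_below: "ereal m \<le> total_functional \<Psi> F q"
    and convex: "convex_on (edom \<Psi>) (\<lambda>q. real_of_ereal (total_functional \<Psi> F q) + \<alpha> * (norm q)\<^sup>2)"
begin

lemma edom_total: "edom (total_functional \<Psi> F) = edom \<Psi>"
  by (auto simp: edom_def total_functional_def)

lemma F_derivative: "(F has_derivative frechet_derivative F (at q)) (at q)"
  using C1 unfolding C1_functional_def by (metis frechet_derivative_at)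

text \<open>
  The hypothesis on \<open>\<Psi>\<close> concerns punctured neighbourhoods; the value at the centre is the
  strict inequality assumed there.
\<close>
lemma total_lsc:
  assumes "a < total_functional \<Psi> F x"
  shows "eventually (\<lambda>y. a < total_functional \<Psi> F y) (nhds x)"
proof -
  have "a - ereal (F x) < \<Psi> x"
    using assms Psi_not_MInf[of x] unfolding total_functional_def
    by (cases a; cases "\<Psi> x") auto
  then obtain b where b: "a - ereal (F x) < ereal b" "ereal b < \<Psi> x"
    using ereal_dense2 by blast
  have "\<Psi> x \<le> Liminf (at x) \<Psi>" using Psi_lsc by (simp add: lower_semicontinuous_def)
  then have "eventually (\<lambda>y. ereal b < \<Psi> y) (at x)"
    using b(2) le_Liminf_iff by blast
  then have ev1: "eventually (\<lambda>y. ereal b < \<Psi> y) (nhds x)"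
    using b(2) by (auto simp: eventually_at_filter elim!: eventually_mono)
  have ev2: "eventually (\<lambda>y. a < ereal (b + F y)) (nhds x)"
  proof (cases a)
    case (real r)
    have "(F \<longlongrightarrow> F x) (nhds x)"
      using has_derivative_continuous[OF F_derivative, of x]
      by (simp add: continuous_at tendsto_at_iff_tendsto_nhds)
    moreover have "r - b < F x" using b(1) real by simp
    ultimately have "eventually (\<lambda>y. r - b < F y) (nhds x)" by (rule order_tendstoD(1))
    then show ?thesis by eventually_elim (simp add: real)
  qed (use b(1) in auto)
  from ev1 ev2 show ?thesis
  proof eventually_elim
    case (elim y)
    have "ereal (b + F y) \<le> total_functional \<Psi> F y"
      using elim(1) unfolding total_functional_def by (cases "\<Psi> y") auto
    with elim(2) show ?case by (rule less_le_trans)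
  qed
qed

sublocale weakly_convex "total_functional \<Psi> F" \<alpha> \<epsilon> m
  by unfold_locales (use eps bounded_below Psi_proper total_lsc convex in \<open>auto simp: edom_total\<close>)

definition Psi_val :: "'x \<Rightarrow> real" where "Psi_val q = real_of_ereal (\<Psi> q)"

lemma Psi_eq: "q \<in> edom \<Psi> \<Longrightarrow> \<Psi> q = ereal (Psi_val q)"
  using Psi_not_MInf[of q] by (cases "\<Psi> q") (auto simp: Psi_val_def edom_def)

lemma fval_eq: "q \<in> edom \<Psi> \<Longrightarrow> fval q = Psi_val q + F q"
  using Psi_eq by (simp add: fval_def total_functional_def)

lemma Psi_val_convex:
  assumes "x \<in> edom \<Psi>" "y \<in> edom \<Psi>" "0 \<le> t" "t \<le> 1"
  shows "Psi_val ((1 - t) *\<^sub>R x + t *\<^sub>R y) \<le> (1 - t) * Psi_val x + t * Psi_val y"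
proof -
  have z: "(1 - t) *\<^sub>R x + t *\<^sub>R y \<in> edom \<Psi>" using segment_in_domain assms edom_total by auto
  have "\<Psi> ((1 - t) *\<^sub>R x + t *\<^sub>R y) \<le> ereal (1 - t) * \<Psi> x + ereal t * \<Psi> y"
    using Psi_convex assms(3,4) unfolding econvex_def by (meson diff_add_cancel diff_ge_0_iff_ge)
  then show ?thesis using Psi_eq assms z by simp
qed

lemma regularization_eq: "regularization \<Psi> F \<epsilon> = envelope"
  by (simp add: fun_eq_iff regularization_def envelope_def)

text \<open>
  The Euler inequality of the minimization problem that defines \<open>prox q\<close>: compare its value at
  \<open>prox q\<close> with the value at a point of the segment towards \<open>\<phi>\<close>, divide by the step and let it tend to
  0. Convexity handles \<open>\<Psi>\<close>, differentiability handles \<open>F\<close>, and the quadratic term leaves the error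
  \<open>2 \<parallel>prox q - q\<parallel> \<parallel>\<phi> - prox q\<parallel>/\<epsilon>\<close>.
\<close>
lemma prox_variational:
  assumes \<phi>: "\<phi> \<in> edom \<Psi>"
  shows "Psi_val \<phi> - Psi_val (prox q) + frechet_derivative F (at (prox q)) (\<phi> - prox q)
    \<ge> - (2 * inverse \<epsilon> * norm (prox q - q)) * norm (\<phi> - prox q)"
proof -
  define p where "p = prox q"
  define v where "v = \<phi> - p"
  have pD: "p \<in> edom \<Psi>" using prox_in_domain by (simp add: p_def edom_total)
  have "eventually (\<lambda>t::real. t > 0) (at_right 0)" by (simp add: eventually_at_right_less)
  moreover have "eventually (\<lambda>t::real. t < 1) (at_right 0)" 
    by (rule order_tendstoD(2)[of "\<lambda>t. t" 0]) (auto intro: tendsto_ident_at)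
  ultimately have ev: "eventually (\<lambda>t. 0 \<le> inverse \<epsilon> * (2 * ((p - q) \<bullet> v) + t * (norm v)\<^sup>2) + (Psi_val \<phi> - Psi_val p)
      + (F (p + t *\<^sub>R v) - F p) / t) (at_right 0)"
  proof eventually_elim
    case (elim t)
    define z where "z = p + t *\<^sub>R v"
    have z: "z = (1 - t) *\<^sub>R p + t *\<^sub>R \<phi>" by (simp add: z_def v_def algebra_simps)
    have zD: "z \<in> edom \<Psi>"
      using segment_in_domain[of p \<phi> t] pD \<phi> elim by (simp add: z edom_total)
    have "penalized q p \<le> penalized q z" using prox_le zD by (simp add: p_def edom_total)
    moreover have "(norm (z - q))\<^sup>2 = (norm (p - q))\<^sup>2 + t * (2 * ((p - q) \<bullet> v) + t * (norm v)\<^sup>2)"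
    proof -
      have zq: "z - q = (p - q) + t *\<^sub>R v" by (simp add: z_def)
      show ?thesis unfolding zq power2_norm_eq_inner
        by (simp add: inner_add_left inner_add_right inner_commute algebra_simps)
    qed
    moreover have "Psi_val z \<le> (1 - t) * Psi_val p + t * Psi_val \<phi>"
      using Psi_val_convex[OF pD \<phi>, of t] elim z by simp
    ultimately have "0 \<le> t * (inverse \<epsilon> * (2 * ((p - q) \<bullet> v) + t * (norm v)\<^sup>2) + (Psi_val \<phi> - Psi_val p))
        + (F z - F p)"
      unfolding penalized_def fval_eq[OF pD] fval_eq[OF zD] by (simp add: algebra_simps)
    then have "0 \<le> (t * (inverse \<epsilon> * (2 * ((p - q) \<bullet> v) + t * (norm v)\<^sup>2) + (Psi_val \<phi> - Psi_val p))
        + (F z - F p)) / t" using elim by simp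
    also have "\<dots> = inverse \<epsilon> * (2 * ((p - q) \<bullet> v) + t * (norm v)\<^sup>2) + (Psi_val \<phi> - Psi_val p) + (F z - F p) / t"
      using elim by (simp add: add_divide_distrib)
    finally show ?case by (simp add: z_def)
  qed
  have "((\<lambda>t. inverse \<epsilon> * (2 * ((p - q) \<bullet> v) + t * (norm v)\<^sup>2) + (Psi_val \<phi> - Psi_val p)
      + (F (p + t *\<^sub>R v) - F p) / t) \<longlongrightarrow>
      inverse \<epsilon> * (2 * ((p - q) \<bullet> v) + 0 * (norm v)\<^sup>2) + (Psi_val \<phi> - Psi_val p)
      + frechet_derivative F (at p) v) (at_right 0)"
    by (intro tendsto_intros directional_derivative_right F_derivative)
  from tendsto_lowerbound[OF this ev]
  have "0 \<le> inverse \<epsilon> * (2 * ((p - q) \<bullet> v)) + (Psi_val \<phi> - Psi_val p) + frechet_derivative F (at p) v"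
    by simp
  moreover have "inverse \<epsilon> * (2 * ((p - q) \<bullet> v)) \<le> inverse \<epsilon> * (2 * (norm (p - q) * norm v))"
    using eps(1) by (intro mult_left_mono norm_cauchy_schwarz) auto
  ultimately have "0 \<le> inverse \<epsilon> * (2 * (norm (p - q) * norm v)) + (Psi_val \<phi> - Psi_val p)
      + frechet_derivative F (at p) v" by linarith
  then show ?thesis by (simp add: p_def[symmetric] v_def[symmetric] algebra_simps)
qed

text \<open>
  From right to left, the error in the variational inequality vanishes. Conversely, a critical point
  \<open>q\<close> satisfies the first order condition for the functional penalized around \<open>q\<close> (the penalty
  has derivative 0 there), and for a convex functional this condition suffices for a minimum.
\<close>
lemma critical_iff_prox: "q \<in> critical_points \<Psi> F \<longleftrightarrow> prox q = q"
proof
  assume fixed: "prox q = q"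
  have qD: "q \<in> edom \<Psi>" using prox_in_domain[of q] fixed by (simp add: edom_total)
  have "\<Psi> \<phi> - \<Psi> q + ereal (frechet_derivative F (at q) (\<phi> - q)) \<ge> 0" if "\<phi> \<in> edom \<Psi>" for \<phi>
    using prox_variational[OF that, of q] fixed by (simp add: Psi_eq that qD)
  with qD show "q \<in> critical_points \<Psi> F" by (simp add: critical_points_def)
next
  assume crit: "q \<in> critical_points \<Psi> F"
  then have qD: "q \<in> edom \<Psi>" by (simp add: critical_points_def)
  have var: "Psi_val \<phi> - Psi_val q + frechet_derivative F (at q) (\<phi> - q) \<ge> 0" if "\<phi> \<in> edom \<Psi>" for \<phi>
  proof -
    have "\<Psi> \<phi> - \<Psi> q + ereal (frechet_derivative F (at q) (\<phi> - q)) \<ge> 0"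
      using crit that by (simp add: critical_points_def)
    then show ?thesis by (simp add: Psi_eq that qD)
  qed
  show "prox q = q"
  proof (rule prox_eqI, unfold is_minimizer_def, intro conjI ballI)
    show "q \<in> edom (total_functional \<Psi> F)" using qD by (simp add: edom_total)
    fix x assume "x \<in> edom (total_functional \<Psi> F)"
    then have xD: "x \<in> edom \<Psi>" by (simp add: edom_total)
    define v where "v = x - q"
    define D where "D = frechet_derivative F (at q)"
    have lin: "D (t *\<^sub>R w) = t * D w" for t w
      using has_derivative_linear[OF F_derivative, of q] by (simp add: D_def linear_cmul)
    have "eventually (\<lambda>t::real. t > 0) (at_right 0)" by (simp add: eventually_at_right_less)
    moreover have "eventually (\<lambda>t::real. t < 1) (at_right 0)" 
      by (rule order_tendstoD(2)[of "\<lambda>t. t" 0]) (auto intro: tendsto_ident_at)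
    ultimately have ev: "eventually (\<lambda>t. - D v + (F (q + t *\<^sub>R v) - F q) / t \<le> penalized q x - penalized q q) (at_right 0)"
    proof eventually_elim
      case (elim t)
      define z where "z = q + t *\<^sub>R v"
      have z: "z = (1 - t) *\<^sub>R q + t *\<^sub>R x" by (simp add: z_def v_def algebra_simps)
      have zD: "z \<in> edom \<Psi>"
        using segment_in_domain[of q x t] qD xD elim by (simp add: z edom_total)
      have "penalized q z \<le> (1 - t) * penalized q q + t * penalized q x - \<kappa> * (t * (1 - t) * (norm (q - x))\<^sup>2)"
        unfolding z using qD xD elim by (intro penalized_strongly_convex) (auto simp: edom_total)
      moreover have "\<kappa> * (t * (1 - t) * (norm (q - x))\<^sup>2) \<ge> 0"
        using kappa_pos elim by simp
      ultimately have "penalized q z - penalized q q \<le> t * (penalized q x - penalized q q)" by (simp add: algebra_simps)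
      moreover have "fval z \<le> penalized q z" using eps(1) by (simp add: penalized_def)
      moreover have "penalized q q = fval q" by (simp add: penalized_def)
      moreover have "Psi_val z - Psi_val q + t * D v \<ge> 0" using var[OF zD] by (simp add: z_def D_def[symmetric] lin)
      ultimately have "- (t * D v) + (F z - F q) \<le> t * (penalized q x - penalized q q)"
        using fval_eq[OF zD] fval_eq[OF qD] by linarith
      then have "(- (t * D v) + (F z - F q)) / t \<le> penalized q x - penalized q q"
        using elim by (simp add: pos_divide_le_eq mult.commute)
      moreover have "(- (t * D v) + (F z - F q)) / t = - D v + (F z - F q) / t"
        using elim by (simp add: diff_divide_distrib add_divide_distrib)
      ultimately show ?case by (simp add: z_def)
    qed
    have "((\<lambda>t. - D v + (F (q + t *\<^sub>R v) - F q) / t) \<longlongrightarrow> - D v + D v) (at_right 0)"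
      unfolding D_def by (intro tendsto_intros directional_derivative_right F_derivative)
    from tendsto_upperbound[OF this ev] show "penalized q q \<le> penalized q x" by simp
  qed
qed

lemma critical_value:
  assumes "q \<in> critical_points \<Psi> F"
  shows "total_functional \<Psi> F q = ereal (envelope q)"
proof -
  have fixed: "prox q = q" using assms critical_iff_prox by simp
  then show ?thesis
    using T_eq[of q] prox_in_domain[of q] by (simp add: envelope_prox fixed)
qed

lemma smooth_critical_points_eq:
  "smooth_critical_points_at envelope c = critical_points_at \<Psi> F c"
  unfolding smooth_critical_points_at_def critical_points_at_def envelope_stationary_iff
    critical_iff_prox[symmetric]
  using critical_value by auto

text \<open>
  The decrease of the envelope along \<open>prox\<close> is at least \<open>\<parallel>prox x - x\<parallel>\<^sup>2/\<epsilon>\<close> and here at most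
  \<open>2/(n + 1)\<close>. So the displacement tends to 0, and with it the error in the variational
  inequality for \<open>prox x\<close>.
\<close>
lemma prox_PS_sequence:
  assumes up: "\<And>n. envelope (x n) < c + 1 / real (Suc n)"
    and low: "\<And>n. c - 1 / real (Suc n) < envelope (prox (x n))"
  shows "PS_sequence \<Psi> F c (\<lambda>n. prox (x n))" and "(\<lambda>n. prox (x n) - x n) \<longlonglongrightarrow> 0"
proof -
  have inv0: "(\<lambda>n. 1 / real (Suc n)) \<longlonglongrightarrow> 0" by (rule LIMSEQ_Suc[OF lim_1_over_n])
  have sq: "inverse \<epsilon> * (norm (prox (x n) - x n))\<^sup>2 \<le> 2 * (1 / real (Suc n))" for n
    using envelope_prox[of "x n"] envelope_prox_le[of "x n"] up[of n] low[of n] by linarith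
  have "(\<lambda>n. (norm (prox (x n) - x n))\<^sup>2) \<longlonglongrightarrow> 0"
  proof (rule tendsto_sandwich[OF _ _ tendsto_const])
    show "(\<lambda>n. \<epsilon> * (2 * (1 / real (Suc n)))) \<longlonglongrightarrow> 0"
      by (rule tendsto_eq_intros inv0 refl)+ simp
    show "eventually (\<lambda>n. (norm (prox (x n) - x n))\<^sup>2 \<le> \<epsilon> * (2 * (1 / real (Suc n)))) sequentially"
    proof (rule always_eventually, rule allI)
      fix n
      have "\<epsilon> * (inverse \<epsilon> * (norm (prox (x n) - x n))\<^sup>2) \<le> \<epsilon> * (2 * (1 / real (Suc n)))"
        using sq eps(1) by (intro mult_left_mono) auto
      then show "(norm (prox (x n) - x n))\<^sup>2 \<le> \<epsilon> * (2 * (1 / real (Suc n)))"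
        using eps(1) by (simp add: mult.assoc[symmetric])
    qed
  qed simp
  then have "(\<lambda>n. sqrt ((norm (prox (x n) - x n))\<^sup>2)) \<longlonglongrightarrow> sqrt 0" by (rule tendsto_real_sqrt)
  then have norm0: "(\<lambda>n. norm (prox (x n) - x n)) \<longlonglongrightarrow> 0" by simp
  then show "(\<lambda>n. prox (x n) - x n) \<longlonglongrightarrow> 0" by (rule tendsto_norm_zero_cancel)
  have fval_lim: "(\<lambda>n. fval (prox (x n))) \<longlonglongrightarrow> c"
  proof (rule tendsto_sandwich)
    show "eventually (\<lambda>n. c - 1 / real (Suc n) \<le> fval (prox (x n))) sequentially"
      using low envelope_prox_le by (intro always_eventually allI less_imp_le) (rule less_le_trans)
    show "eventually (\<lambda>n. fval (prox (x n)) \<le> c + 1 / real (Suc n)) sequentially"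
    proof (rule always_eventually, rule allI)
      fix n
      have "0 \<le> inverse \<epsilon> * (norm (prox (x n) - x n))\<^sup>2" using eps(1) by simp
      then show "fval (prox (x n)) \<le> c + 1 / real (Suc n)"
        using envelope_prox[of "x n"] up[of n] by linarith
    qed
    show "(\<lambda>n. c - 1 / real (Suc n)) \<longlonglongrightarrow> c"
      by (rule tendsto_eq_intros inv0 refl)+ simp
    show "(\<lambda>n. c + 1 / real (Suc n)) \<longlonglongrightarrow> c"
      by (rule tendsto_eq_intros inv0 refl)+ simp
  qed
  show "PS_sequence \<Psi> F c (\<lambda>n. prox (x n))"
    unfolding PS_sequence_def
  proof (intro conjI allI exI[of _ "\<lambda>n. 2 * inverse \<epsilon> * norm (prox (x n) - x n)"] ballI)
    show D: "prox (x n) \<in> edom \<Psi>" for n using prox_in_domain by (simp add: edom_total)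
    show "(\<lambda>n. total_functional \<Psi> F (prox (x n))) \<longlonglongrightarrow> ereal c"
      using fval_lim by (simp add: T_eq[OF prox_in_domain])
    show "0 \<le> 2 * inverse \<epsilon> * norm (prox (x n) - x n)" for n using eps(1) by simp
    show "(\<lambda>n. 2 * inverse \<epsilon> * norm (prox (x n) - x n)) \<longlonglongrightarrow> 0"
      using tendsto_mult_right_zero[OF norm0, of "2 * inverse \<epsilon>"] by simp
    show "ereal (- (2 * inverse \<epsilon> * norm (prox (x n) - x n)) * norm (\<phi> - prox (x n)))
        \<le> \<Psi> \<phi> - \<Psi> (prox (x n)) + ereal (frechet_derivative F (at (prox (x n))) (\<phi> - prox (x n)))"
      if "\<phi> \<in> edom \<Psi>" for n \<phi>
      using prox_variational[OF that, of "x n"] by (simp add: Psi_eq that D)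
  qed
qed

lemma almost_critical_points_accumulate:
  fixes \<iota> :: "'x \<Rightarrow> 'y::real_normed_vector"
  assumes wPS: "wPS \<iota> \<Psi> F c" and "bounded_linear \<iota>"
    and x: "\<And>n. envelope (x n) < c + 1 / real (Suc n)" "\<And>n. c - 1 / real (Suc n) < envelope (prox (x n))"
  obtains r q where "strict_mono (r :: nat \<Rightarrow> nat)" "q \<in> critical_points_at \<Psi> F (ereal c)"
    "(\<lambda>n. \<iota> (x (r n))) \<longlonglongrightarrow> \<iota> q"
proof -
  obtain r q where r: "strict_mono (r :: nat \<Rightarrow> nat)" "q \<in> critical_points_at \<Psi> F (ereal c)"
    "(\<lambda>n. \<iota> (prox (x (r n)))) \<longlonglongrightarrow> \<iota> q"
    using wPS prox_PS_sequence(1)[OF x] unfolding wPS_def by blast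
  have "(\<lambda>n. prox (x (r n)) - x (r n)) \<longlonglongrightarrow> 0"
    using LIMSEQ_subseq_LIMSEQ[OF prox_PS_sequence(2)[OF x] r(1)] by (simp add: o_def)
  then have "(\<lambda>n. \<iota> (prox (x (r n)) - x (r n))) \<longlonglongrightarrow> \<iota> 0"
    by (rule bounded_linear.tendsto[OF \<open>bounded_linear \<iota>\<close>])
  then have "(\<lambda>n. \<iota> (prox (x (r n))) - \<iota> (prox (x (r n)) - x (r n))) \<longlonglongrightarrow> \<iota> q - \<iota> 0"
    by (intro tendsto_diff r(3))
  then have "(\<lambda>n. \<iota> (x (r n))) \<longlonglongrightarrow> \<iota> q"
    using linear_diff[OF bounded_linear.linear[OF \<open>bounded_linear \<iota>\<close>]]
      linear_0[OF bounded_linear.linear[OF \<open>bounded_linear \<iota>\<close>]] by simp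
  with r that show thesis by blast
qed

end

section \<open>The symmetric minimax principle\<close>

text \<open>
  Here \<open>R\<close> is the representation on \<open>X\<close> and \<open>L\<close> the one on \<open>Y\<close>. The two enter differently: the
  functional, its critical points and the minimax sets live in \<open>X\<close>, whereas limits of
  Palais--Smale sequences are taken in \<open>Y\<close>.
\<close>
locale symmetric_problem = convex_plus_smooth \<Psi> F \<alpha> \<epsilon> m
  for \<Psi> :: "'x::{real_inner, complete_space} \<Rightarrow> ereal" and F \<alpha> \<epsilon> m +
  fixes \<iota> :: "'x \<Rightarrow> 'y::real_normed_vector" and L :: "real \<Rightarrow> 'y \<Rightarrow> 'y" and R and \<omega> :: real
  assumes inj: "inj \<iota>" and \<iota>: "bounded_linear \<iota>"
    and L: "isometric_rep L" and range_inv: "\<And>\<theta>. L \<theta> ` range \<iota> = range \<iota>"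
    and R_def: "R = restrict_rep \<iota> L" and R: "isometric_rep R"
    and Psi_inv: "invariant_functional R \<Psi>" and F_inv: "invariant_functional R F"
    and \<omega>: "\<omega> < 0" and wPS: "\<And>c. c < \<omega> \<Longrightarrow> wPS \<iota> \<Psi> F c"
    and no_fixed: "fixed_points L \<inter> \<iota> ` (sublevel_neg \<Psi> F \<inter> critical_points \<Psi> F) = {}"
begin

lemma iota_R: "\<iota> (R \<theta> x) = L \<theta> (\<iota> x)"
  unfolding R_def restrict_rep_def using range_inv by (intro f_inv_into_f) blast

lemma total_R: "total_functional \<Psi> F (R \<theta> x) = total_functional \<Psi> F x"
  using Psi_inv F_inv unfolding invariant_functional_def total_functional_def
  by (metis comp_apply)

lemma prox_R: "prox (R \<theta> x) = R \<theta> (prox x)"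
proof (rule prox_equivariant)
  show "norm (R \<theta> x - R \<theta> y) = norm (x - y)" for x y
  proof -
    have "bounded_linear (R \<theta>)" using R by (simp add: isometric_rep_def)
    then have "R \<theta> x - R \<theta> y = R \<theta> (x - y)" by (simp add: linear_diff bounded_linear.linear)
    then show ?thesis using R by (simp add: isometric_rep_def)
  qed
  show "surj (R \<theta>)"
    by (rule surjI[of _ "R (- \<theta>)"]) (use isometric_rep_inverse[OF R, of "- \<theta>"] in simp)
qed (rule total_R)

lemma critical_R:
  "q \<in> critical_points_at \<Psi> F c \<Longrightarrow> orbit R q \<subseteq> critical_points_at \<Psi> F c"
  by (auto simp: orbit_def critical_points_at_def critical_iff_prox prox_R total_R)

lemma minimax_level_real:
  assumes "j \<ge> 1" "minimax_level R envelope j < ereal \<omega>"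
  obtains c where "minimax_level R envelope j = ereal c" "c < \<omega>"
proof -
  have "ereal m \<le> minimax_level R envelope j"
    unfolding minimax_level_def
  proof (rule INF_greatest)
    fix A assume "A \<in> index_class R j"
    then obtain x where "x \<in> A" using index_class_nonempty assms(1) by blast
    then have "ereal (envelope x) \<le> (SUP x\<in>A. ereal (envelope x))" by (rule SUP_upper)
    then show "ereal m \<le> (SUP x\<in>A. ereal (envelope x))"
      using envelope_ge[of x] by (meson ereal_less_eq(3) order_trans)
  qed
  then show thesis using that assms(2) by (cases "minimax_level R envelope j") auto
qed

text \<open>
  The points \<open>x n\<close> are chosen in prescribed sets \<open>A n\<close>. With the choice \<open>A n \<inter> {\<psi> = 0}\<close> this locates
  the critical point, and so the same statement yields existence and multiplicity.
\<close>
lemma almost_optimal_sets_accumulate: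
  assumes c: "minimax_level R envelope j = ereal c" "c < \<omega>"
    and A: "\<And>n. A n \<in> index_class R j" "\<And>n x. x \<in> A n \<Longrightarrow> envelope x < c + 1 / real (Suc n)"
  obtains x r q where "\<And>n. x n \<in> A n" "strict_mono (r :: nat \<Rightarrow> nat)"
    "q \<in> critical_points_at \<Psi> F (ereal c)" "(\<lambda>n. \<iota> (x (r n))) \<longlonglongrightarrow> \<iota> q"
proof -
  have "\<exists>x\<in>A n. c - 1 / real (Suc n) < envelope (prox x)" for n
    using minimax_level_linking[OF c(1), of "1 / real (Suc n)" "A n" prox] A(1) prox_continuous prox_R
    by (metis of_nat_0_less_iff zero_less_Suc zero_less_divide_1_iff)
  then obtain x where x: "\<And>n. x n \<in> A n" "\<And>n. c - 1 / real (Suc n) < envelope (prox (x n))"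
    by metis
  from almost_critical_points_accumulate[OF wPS[OF c(2)] \<iota> A(2)[OF x(1)] x(2)] that x(1)
  show thesis by metis
qed

lemma minimax_level_critical:
  assumes c: "minimax_level R envelope j = ereal c" "c < \<omega>"
  shows "critical_points_at \<Psi> F (ereal c) \<noteq> {}"
proof -
  have "\<exists>A\<in>index_class R j. \<forall>x\<in>A. envelope x < c + 1 / real (Suc n)" for n
    using minimax_level_approx[OF c(1), of "1 / real (Suc n)"]
    by (metis of_nat_0_less_iff zero_less_Suc zero_less_divide_1_iff)
  then obtain A where A: "\<And>n. A n \<in> index_class R j" "\<And>n x. x \<in> A n \<Longrightarrow> envelope x < c + 1 / real (Suc n)"
    by metis
  obtain q where "q \<in> critical_points_at \<Psi> F (ereal c)"
    by (rule almost_optimal_sets_accumulate[OF c, of A]) (use A in auto)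
  then show ?thesis by blast
qed

text \<open>
  Choose one point on each orbit. Since \<open>\<iota>\<close> is injective and equivariant, distinct orbits in \<open>X\<close> have
  distinct images in \<open>Y\<close>; since \<open>c < 0\<close>, none of the chosen points is fixed.
\<close>
lemma finitely_many_orbits_detected:
  assumes "c < 0" and fin: "finite (orbits_in R (critical_points_at \<Psi> F (ereal c)))"
  obtains \<psi> p where "p \<ge> 1" "continuous_on UNIV \<psi>" "\<And>t y. \<psi> (L t y) = weight p t * \<psi> y"
    "\<And>q. q \<in> critical_points_at \<Psi> F (ereal c) \<Longrightarrow> \<psi> (\<iota> q) \<noteq> 0"
proof -
  define K where "K = critical_points_at \<Psi> F (ereal c)"
  define \<rho> where "\<rho> = (\<lambda>Q. SOME q. q \<in> (Q :: 'x set))"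
  define S where "S = (\<lambda>Q. \<iota> (\<rho> Q)) ` orbits_in R K"
  have \<rho>: "\<rho> Q \<in> K" "Q = orbit R (\<rho> Q)" if Q: "Q \<in> orbits_in R K" for Q
  proof -
    obtain q where q: "Q = orbit R q" "Q \<subseteq> K" using Q by (auto simp: orbits_in_def)
    have "\<rho> Q \<in> Q" unfolding \<rho>_def using mem_orbit[OF R, of q] q(1) by (metis someI)
    then show "\<rho> Q \<in> K" "Q = orbit R (\<rho> Q)" using q orbit_eq_if_mem[OF R] by auto
  qed
  have fS: "finite S" using fin by (simp add: S_def K_def)
  have nf: "S \<inter> fixed_points L = {}"
  proof -
    have "q \<in> sublevel_neg \<Psi> F \<inter> critical_points \<Psi> F" if "q \<in> K" for q
      using that \<open>c < 0\<close> by (auto simp: K_def critical_points_at_def sublevel_neg_def)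
    then show ?thesis using no_fixed \<rho>(1) by (auto simp: S_def)
  qed
  have reps: "inj_on (orbit L) S"
  proof (rule inj_onI)
    fix y z assume yz: "y \<in> S" "z \<in> S" "orbit L y = orbit L z"
    then obtain P Q where PQ: "P \<in> orbits_in R K" "Q \<in> orbits_in R K" "y = \<iota> (\<rho> P)" "z = \<iota> (\<rho> Q)"
      by (auto simp: S_def)
    have "z \<in> orbit L y" using mem_orbit[OF L, of z] yz(3) by simp
    then obtain t where "L t y = z" by (auto simp: orbit_def)
    then have "R t (\<rho> P) = \<rho> Q" using inj PQ by (simp add: iota_R[symmetric] inj_eq)
    then have "\<rho> Q \<in> orbit R (\<rho> P)" unfolding orbit_def by (metis rangeI)
    then have "P = Q" using orbit_eq_if_mem[OF R] \<rho>(2) PQ(1,2) by metis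
    then show "y = z" using PQ by simp
  qed
  obtain \<psi> p where \<psi>: "p \<ge> 1" "continuous_on UNIV \<psi>"
    "\<And>t y. \<psi> (L t y) = weight p t * \<psi> y" "\<And>y. y \<in> S \<Longrightarrow> \<psi> y \<noteq> 0"
    using equivariant_map_nonzero_on_orbits[OF L fS nf reps] by metis
  show thesis
  proof (rule that[OF \<psi>(1-3)])
    fix q assume "q \<in> critical_points_at \<Psi> F (ereal c)"
    then have Q: "orbit R q \<in> orbits_in R K"
      using critical_R by (auto simp: orbits_in_def K_def)
    have "\<rho> (orbit R q) \<in> orbit R q"
      using \<rho>(2)[OF Q] mem_orbit[OF R] by metis
    then obtain t where "\<rho> (orbit R q) = R t q" by (auto simp: orbit_def)
    then have "\<psi> (\<iota> (\<rho> (orbit R q))) = weight p t * \<psi> (\<iota> q)"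
      by (simp add: iota_R \<psi>(3))
    moreover have "\<psi> (\<iota> (\<rho> (orbit R q))) \<noteq> 0"
      using Q by (intro \<psi>(4)) (simp add: S_def)
    ultimately show "\<psi> (\<iota> q) \<noteq> 0" by auto
  qed
qed

text \<open>
  Otherwise a function \<open>\<psi>\<close> detects all critical orbits at the level \<open>c\<close>. Cutting \<open>{\<psi> \<noteq> 0}\<close> out of
  sets that are almost optimal for \<open>k\<close> leaves sets that are almost optimal for \<open>j\<close>, and these
  accumulate at a critical point at the level \<open>c\<close> where \<open>\<psi>\<close> vanishes.
\<close>
lemma coinciding_levels_infinite:
  assumes "j < k" and cj: "minimax_level R envelope j = ereal c" and ck: "minimax_level R envelope k = ereal c"
    and "c < \<omega>"
  shows "infinite (orbits_in R (critical_points_at \<Psi> F (ereal c)))"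
proof
  assume fin: "finite (orbits_in R (critical_points_at \<Psi> F (ereal c)))"
  have "c < 0" using \<open>c < \<omega>\<close> \<omega> by simp
  obtain \<psi> p where \<psi>: "p \<ge> 1" "continuous_on UNIV \<psi>" "\<And>t y. \<psi> (L t y) = weight p t * \<psi> y"
    "\<And>q. q \<in> critical_points_at \<Psi> F (ereal c) \<Longrightarrow> \<psi> (\<iota> q) \<noteq> 0"
    using finitely_many_orbits_detected[OF \<open>c < 0\<close> fin] by metis
  have \<psi>\<iota>: "continuous_on UNIV (\<lambda>x. \<psi> (\<iota> x))"
    by (rule continuous_on_compose2[OF \<psi>(2)])
      (auto intro: linear_continuous_on \<iota>)
  have "\<exists>A\<in>index_class R k. \<forall>x\<in>A. envelope x < c + 1 / real (Suc n)" for n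
    using minimax_level_approx[OF ck, of "1 / real (Suc n)"]
    by (metis of_nat_0_less_iff zero_less_Suc zero_less_divide_1_iff)
  then obtain A where A: "\<And>n. A n \<in> index_class R k" "\<And>n x. x \<in> A n \<Longrightarrow> envelope x < c + 1 / real (Suc n)"
    by metis
  define B where "B = (\<lambda>n. {x \<in> A n. \<psi> (\<iota> x) = 0})"
  have "B n \<in> index_class R j" for n
    unfolding B_def
    by (rule index_class_remove[OF R A(1) \<open>j < k\<close> \<psi>\<iota> \<psi>(1)]) (simp add: iota_R \<psi>(3))
  moreover have "\<And>n x. x \<in> B n \<Longrightarrow> envelope x < c + 1 / real (Suc n)"
    using A(2) by (simp add: B_def)
  ultimately obtain x r q where x: "\<And>n. x n \<in> B n" "strict_mono (r :: nat \<Rightarrow> nat)"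
    "q \<in> critical_points_at \<Psi> F (ereal c)" "(\<lambda>n. \<iota> (x (r n))) \<longlonglongrightarrow> \<iota> q"
    using almost_optimal_sets_accumulate[OF cj \<open>c < \<omega>\<close>, of B] by metis
  have "(\<lambda>n. \<psi> (\<iota> (x (r n)))) \<longlonglongrightarrow> \<psi> (\<iota> q)"
    using continuous_on_tendsto_compose[OF \<psi>(2) x(4)] by simp
  moreover have "\<psi> (\<iota> (x (r n))) = 0" for n using x(1)[of "r n"] by (simp add: B_def)
  ultimately have "\<psi> (\<iota> q) = 0" by (simp add: LIMSEQ_const_iff)
  with \<psi>(4) x(3) show False by blast
qed

lemma critical_orbits_negative:
  assumes "c < \<omega>"
  shows "orbits_in R (critical_points_at \<Psi> F (ereal c)) \<subseteq> orbits_in R (critical_points \<Psi> F \<inter> sublevel_neg \<Psi> F)"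
  using assms \<omega> by (fastforce simp: orbits_in_def critical_points_at_def sublevel_neg_def)

lemma many_critical_orbits:
  assumes "minimax_level R envelope k < ereal \<omega>"
  shows "\<exists>S. finite S \<and> card S = k \<and> S \<subseteq> orbits_in R (critical_points \<Psi> F \<inter> sublevel_neg \<Psi> F)"
proof -
  have "\<exists>c. minimax_level R envelope j = ereal c \<and> c < \<omega>" if "j \<in> {1..k}" for j
  proof -
    have "minimax_level R envelope j < ereal \<omega>"
      using minimax_level_mono[of j k R envelope] that assms by (simp add: le_less_trans)
    then show ?thesis using minimax_level_real[of j] that by auto
  qed
  then obtain c where c: "\<And>j. j \<in> {1..k} \<Longrightarrow> minimax_level R envelope j = ereal (c j)"
    "\<And>j. j \<in> {1..k} \<Longrightarrow> c j < \<omega>" by metis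
  show ?thesis
  proof (cases "inj_on c {1..k}")
    case True
    have "\<exists>q. q \<in> critical_points_at \<Psi> F (ereal (c j))" if "j \<in> {1..k}" for j
      using minimax_level_critical[OF c(1)[OF that] c(2)[OF that]] by blast
    then obtain q where q: "\<And>j. j \<in> {1..k} \<Longrightarrow> q j \<in> critical_points_at \<Psi> F (ereal (c j))"
      by metis
    have "inj_on (\<lambda>j. orbit R (q j)) {1..k}"
    proof (rule inj_onI)
      fix i j assume ij: "i \<in> {1..k}" "j \<in> {1..k}" "orbit R (q i) = orbit R (q j)"
      then have "q i \<in> orbit R (q j)" using mem_orbit[OF R] by metis
      then have "q i \<in> critical_points_at \<Psi> F (ereal (c j))" using critical_R q ij(2) by blast
      with q[OF ij(1)] have "c i = c j" by (simp add: critical_points_at_def)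
      then show "i = j" using True ij by (simp add: inj_on_eq_iff)
    qed
    then have "card ((\<lambda>j. orbit R (q j)) ` {1..k}) = k" by (simp add: card_image)
    moreover have "orbit R (q j) \<in> orbits_in R (critical_points \<Psi> F \<inter> sublevel_neg \<Psi> F)" if "j \<in> {1..k}" for j
      using critical_orbits_negative[OF c(2)[OF that]] critical_R[OF q[OF that]]
      by (auto simp: orbits_in_def)
    ultimately show ?thesis
      by (intro exI[of _ "(\<lambda>j. orbit R (q j)) ` {1..k}"]) auto
  next
    case False
    then obtain i j where ij: "i \<in> {1..k}" "j \<in> {1..k}" "c i = c j" "i < j"
      unfolding inj_on_def by (metis linorder_neq_iff)
    then have "infinite (orbits_in R (critical_points_at \<Psi> F (ereal (c i))))"
      using coinciding_levels_infinite c by metis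
    then obtain S where "finite S" "card S = k" "S \<subseteq> orbits_in R (critical_points_at \<Psi> F (ereal (c i)))"
      using infinite_arbitrarily_large by blast
    then show ?thesis using critical_orbits_negative[OF c(2)[OF ij(1)]] by blast
  qed
qed

end

theorem theorem3:
  fixes \<iota> :: "'x::{real_inner, complete_space} \<Rightarrow> 'y::banach"
    and L :: "real \<Rightarrow> 'y \<Rightarrow> 'y"
    and \<Psi> :: "'x \<Rightarrow> ereal"
    and F :: "'x \<Rightarrow> real"
    and \<alpha> \<omega> \<epsilon> :: real
  defines "R \<equiv> restrict_rep \<iota> L"
    and "I\<epsilon> \<equiv> regularization \<Psi> F \<epsilon>"
  assumes "inj \<iota>" and "compact_operator \<iota>"
    and "isometric_rep L"
    and "\<And>\<theta>. L \<theta> ` range \<iota> = range \<iota>"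
    and "isometric_rep R"
    and "fixed_points L \<subseteq> range \<iota>"
    and "C1_functional F"
    and "\<And>q. \<Psi> q \<noteq> -\<infinity>"
    and "econvex \<Psi>" and "lower_semicontinuous \<Psi>" and "edom \<Psi> \<noteq> {}"
    and "invariant_functional R \<Psi>" and "invariant_functional R F"
    and "\<exists>m::real. \<forall>q. total_functional \<Psi> F q \<ge> ereal m"
    and "\<alpha> > 0"
    and "convex_on (edom \<Psi>) (\<lambda>q. real_of_ereal (total_functional \<Psi> F q) + \<alpha> * (norm q)\<^sup>2)"
    and "total_functional \<Psi> F 0 = 0"
    and "\<omega> < 0"
    and "\<And>d. d < \<omega> \<Longrightarrow> wPS \<iota> \<Psi> F d"
    and "fixed_points L \<inter> \<iota> ` (sublevel_neg \<Psi> F \<inter> critical_points \<Psi> F) = {}"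
    and "0 < \<epsilon>" and "\<epsilon> < inverse \<alpha>"
  shows
    "(\<forall>j\<ge>1. minimax_level R I\<epsilon> j < ereal \<omega> \<longrightarrow>
        smooth_critical_points_at I\<epsilon> (minimax_level R I\<epsilon> j)
          = critical_points_at \<Psi> F (minimax_level R I\<epsilon> j) \<and>
        critical_points_at \<Psi> F (minimax_level R I\<epsilon> j) \<noteq> {}) \<and>
     (\<forall>j\<ge>1. \<forall>k>j. minimax_level R I\<epsilon> j = minimax_level R I\<epsilon> k \<and>
        minimax_level R I\<epsilon> k < ereal \<omega> \<longrightarrow>
        infinite (orbits_in R (critical_points_at \<Psi> F (minimax_level R I\<epsilon> j)))) \<and>
     (\<forall>k\<ge>1. minimax_level R I\<epsilon> k < ereal \<omega> \<longrightarrow>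
        (\<exists>S. finite S \<and> card S = k \<and>
           S \<subseteq> orbits_in R (critical_points \<Psi> F \<inter> sublevel_neg \<Psi> F)))"
proof -
  obtain m :: real where m: "\<And>q. total_functional \<Psi> F q \<ge> ereal m"
    using \<open>\<exists>m::real. \<forall>q. total_functional \<Psi> F q \<ge> ereal m\<close> by blast
  have R_eq: "R = restrict_rep \<iota> L" unfolding R_def ..
  have bounded_linear: "bounded_linear \<iota>"
    using \<open>compact_operator \<iota>\<close> by (simp add: compact_operator_def)
  interpret symmetric_problem \<Psi> F \<alpha> \<epsilon> m \<iota> L R \<omega>
    by (intro symmetric_problem.intro symmetric_problem_axioms.intro convex_plus_smooth.intro)
      (fact assms m R_eq bounded_linear)+
  have I\<epsilon>: "I\<epsilon> = envelope" unfolding I\<epsilon>_def by (rule regularization_eq)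
  show ?thesis
    unfolding I\<epsilon>
  proof (intro conjI allI impI)
    fix j :: nat assume "1 \<le> j" "minimax_level R envelope j < ereal \<omega>"
    then obtain c where c: "minimax_level R envelope j = ereal c" "c < \<omega>"
      using minimax_level_real by blast
    show "smooth_critical_points_at envelope (minimax_level R envelope j)
        = critical_points_at \<Psi> F (minimax_level R envelope j)"
      by (rule smooth_critical_points_eq)
    show "critical_points_at \<Psi> F (minimax_level R envelope j) \<noteq> {}"
      unfolding c(1) by (rule minimax_level_critical[OF c])
  next
    fix j k :: nat
    assume "1 \<le> j" "j < k"
      and eq: "minimax_level R envelope j = minimax_level R envelope k \<and> minimax_level R envelope k < ereal \<omega>"
    then obtain c where c: "minimax_level R envelope j = ereal c" "c < \<omega>"
      using minimax_level_real[of j] by auto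
    then show "infinite (orbits_in R (critical_points_at \<Psi> F (minimax_level R envelope j)))"
      using coinciding_levels_infinite[OF \<open>j < k\<close>] eq by simp
  next
    fix k :: nat assume "minimax_level R envelope k < ereal \<omega>"
    then show "\<exists>S. finite S \<and> card S = k \<and> S \<subseteq> orbits_in R (critical_points \<Psi> F \<inter> sublevel_neg \<Psi> F)"
      by (rule many_critical_orbits)
  qed
qed

end
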